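(* Let $u>0$ be fixed. For $r\ge1$ let $n=\eta(S_{W_r})$, which is almost surely finite, where $S_{W_r}=\{(x,m)\in\mathbb{R}^d\times\mathbb{M}:(K_m+x)\cap W_r\ne\emptyset\}$, and denote the points of $\eta$ in $S_{W_r}$ by $(x_1,m_1),\dots,(x_n,m_n)$. For $\emptyset\ne I\subseteq\{1,\dots,n\}$ define $$X_I=\Bigl\{y\in W_r:\ \sum_{j\in I}g_{m_j}(y-x_j)\ge u,\ y\in K_{m_j}+x_j\text{ for all }j\in I\Bigr\}.$$ Then, for all $r\ge1$, on the almost sure event that $n<\infty$, $X_I$ is a compact convex set for all $\emptyset\ne I\subseteq\{1,\dots,n\}$ and $$Z_u\cap W_r=\bigcup_{\emptyset\ne I\subseteq\{1,\dots,n\}}X_I.$$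
   Context: $d\in\mathbb{N}$, $(\mathbb{M},\mathcal{F}_{\mathbb{M}},\mathbb{Q})$ is a probability space (mark space), $\gamma>0$, $\lambda_d$ is Lebesgue measure, and $\eta$ is a Poisson process on $\mathbb{R}^d\times\mathbb{M}$ with intensity measure $\lambda=\gamma\lambda_d\otimes\mathbb{Q}$. $\widetilde L^1(\mathbb{R}^d)$ is the space of integrable functions on $\mathbb{R}^d$ with compact convex closed support $K$ whose restriction to $K$ is continuous, equipped with the Borel $\sigma$-algebra $\mathcal{L}_1$ induced by the $L^1$-norm. $(g_m)_{m\in\mathbb{M}}$ is a family of measurable functions $g_m:\mathbb{R}^d\to[0,\infty)$ in $\widetilde L^1(\mathbb{R}^d)$, each concave on its non-empty compact convex closed support $K_m=\overline{\{x:g_m(x)>0\}}$, with $\lambda_d(K_m)>0$, and such that $m\mapsto g_m$ is $\mathcal{F}_{\mathbb{M}}$-$\mathcal{L}_1$-measurable. Standing assumption: $\int_{\mathbb{M}}V_i(K_m)\,\mathbb{Q}(\mathrm{d}m)<\infty$ for $i\in\{1,\dots,d\}$, where $V_i$ are the intrinsic volumes. The Poisson shot noise process is $f_\eta(y)=\sum_{(x,m)\in\eta}g_m(y-x)$, and its excursion set is $Z_u=\{y\in\mathbb{R}^d:f_\eta(y)\ge u\}$. We consider an increasing sequence of observation windows $(W_r)_{r\ge1}$ with $W_r=rW$ for a compact convex set $W\subset\mathbb{R}^d$ with $\lambda_d(W)>0$. *)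

theory Defs
  imports "HOL-Probability.Probability"
begin

section \<open>Intrinsic volumes\<close>

text \<open>
  \<open>V\<^sub>0, \<dots>, V\<^sub>d\<close> are the coefficients in the Steiner formula
  \<open>\<lambda>\<^sub>d(K + tB) = (\<Sum>i\<le>d. \<kappa>\<^sub>d\<^sub>-\<^sub>i t\<^sup>d\<^sup>-\<^sup>i V\<^sub>i(K))\<close> for all \<open>t \<ge> 0\<close>, where \<open>B\<close> is the closed unit ball and
  \<open>\<kappa>\<^sub>j\<close> is the volume of the \<open>j\<close>-dimensional unit ball.  The convention \<open>v i = 0\<close> for \<open>i > d\<close>
  makes the coefficient sequence unique.  The definition is meaningful for compact convex \<open>K\<close>.
\<close>

definition parallel_body :: "'a::euclidean_space set \<Rightarrow> real \<Rightarrow> 'a set" where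
  "parallel_body K t = (\<Union>x\<in>K. cball x t)"

definition intrinsic_volume :: "nat \<Rightarrow> 'a::euclidean_space set \<Rightarrow> real" where
  "intrinsic_volume i K =
     (THE v :: nat \<Rightarrow> real.
        (\<forall>t\<ge>0. measure lborel (parallel_body K t) =
           (\<Sum>j\<le>DIM('a). unit_ball_vol (real (DIM('a) - j)) * t ^ (DIM('a) - j) * v j)) \<and>
        (\<forall>j>DIM('a). v j = 0)) i"

section \<open>The space of integrable functions that are continuous on a compact convex support\<close>

definition closed_support :: "('a::topological_space \<Rightarrow> real) \<Rightarrow> 'a set" where
  "closed_support f = closure {x. f x \<noteq> 0}"

definition L1_tilde :: "('a::euclidean_space \<Rightarrow> real) set" where
  "L1_tilde = {f. integrable lborel f \<and> compact (closed_support f) \<and> convex (closed_support f) \<and>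
                  continuous_on (closed_support f) f}"

definition L1_dist :: "('a::euclidean_space \<Rightarrow> real) \<Rightarrow> ('a \<Rightarrow> real) \<Rightarrow> real" where
  "L1_dist f h = (LINT x|lborel. \<bar>f x - h x\<bar>)"

text \<open>
  On functions (as opposed to classes of functions modulo null sets) \<^const>\<open>L1_dist\<close> is only a
  pseudometric, so its topology is spelled out here.
\<close>

definition L1_open :: "('a::euclidean_space \<Rightarrow> real) set \<Rightarrow> bool" where
  "L1_open U \<longleftrightarrow> U \<subseteq> L1_tilde \<and>
     (\<forall>f\<in>U. \<exists>e>0. \<forall>h\<in>L1_tilde. L1_dist f h < e \<longrightarrow> h \<in> U)"

definition L1_borel :: "('a::euclidean_space \<Rightarrow> real) measure" where
  "L1_borel = sigma L1_tilde {U. L1_open U}"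

section \<open>Poisson processes\<close>

text \<open>
  A realisation of a point process is a counting measure, given by its multiplicity function \<open>c\<close>:
  \<open>c z\<close> is the number of points located at \<open>z\<close>.  It assigns to a set \<open>B\<close> the number
  \<open>point_count c B\<close> of points in \<open>B\<close>, counted with multiplicity and possibly infinite.
\<close>

definition point_count :: "('a \<Rightarrow> nat) \<Rightarrow> 'a set \<Rightarrow> ennreal" where
  "point_count c B = (\<Sum>\<^sub>\<infinity>z\<in>B. of_nat (c z))"

definition point_process :: "'w measure \<Rightarrow> 'a measure \<Rightarrow> ('w \<Rightarrow> 'a \<Rightarrow> nat) \<Rightarrow> bool" where
  "point_process P \<Lambda> \<eta> \<longleftrightarrow>
     (\<forall>\<omega>\<in>space P. countable {z. \<eta> \<omega> z \<noteq> 0} \<and> {z. \<eta> \<omega> z \<noteq> 0} \<subseteq> space \<Lambda>) \<and>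
     (\<forall>B\<in>sets \<Lambda>. (\<lambda>\<omega>. point_count (\<eta> \<omega>) B) \<in> borel_measurable P)"

definition poisson_process :: "'w measure \<Rightarrow> 'a measure \<Rightarrow> ('w \<Rightarrow> 'a \<Rightarrow> nat) \<Rightarrow> bool" where
  "poisson_process P \<Lambda> \<eta> \<longleftrightarrow>
     prob_space P \<and> point_process P \<Lambda> \<eta> \<and>
     (\<forall>B\<in>sets \<Lambda>. emeasure \<Lambda> B < \<infinity> \<longrightarrow>
        (\<forall>k::nat. measure P {\<omega>\<in>space P. point_count (\<eta> \<omega>) B = of_nat k} =
                  measure \<Lambda> B ^ k / fact k * exp (- measure \<Lambda> B))) \<and>
     (\<forall>B\<in>sets \<Lambda>. emeasure \<Lambda> B = \<infinity> \<longrightarrow> (AE \<omega> in P. point_count (\<eta> \<omega>) B = \<infinity>)) \<and>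
     (\<forall>(k::nat) B. (\<forall>i<k. B i \<in> sets \<Lambda>) \<and> disjoint_family_on B {..<k} \<longrightarrow>
        prob_space.indep_vars P (\<lambda>_. borel) (\<lambda>i \<omega>. point_count (\<eta> \<omega>) (B i)) {..<k})"

text \<open>
  \<open>(x\<^sub>1,m\<^sub>1), \<dots>, (x\<^sub>n,m\<^sub>n)\<close> is a list of the points of \<open>c\<close> in \<open>S\<close>, each occurring according to its
  multiplicity.  By the lemma below such a list exists whenever there are \<open>n\<close> points in \<open>S\<close>.
\<close>

definition lists_points ::
  "('a \<times> 'm \<Rightarrow> nat) \<Rightarrow> ('a \<times> 'm) set \<Rightarrow> nat \<Rightarrow> (nat \<Rightarrow> 'a) \<Rightarrow> (nat \<Rightarrow> 'm) \<Rightarrow> bool" where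
  "lists_points c S n x m \<longleftrightarrow>
     (\<forall>j\<in>{1..n}. (x j, m j) \<in> S) \<and> (\<forall>z\<in>S. card {j\<in>{1..n}. (x j, m j) = z} = c z)"

lemma lists_points_exists:
  assumes "point_count c S = of_nat n"
  shows "\<exists>x m. lists_points c S n x m"
proof -
  define T where "T = {z\<in>S. c z \<noteq> 0}"
  have summ: "(\<lambda>z. of_nat (c z) :: ennreal) summable_on A" for A
    by (rule nonneg_summable_on_complete) simp
  have card_le: "card F \<le> n" if F: "finite F" "F \<subseteq> T" for F
  proof -
    have "of_nat (card F) = (\<Sum>z\<in>F. 1 :: ennreal)" by simp
    also have "\<dots> \<le> (\<Sum>z\<in>F. of_nat (c z))"
    proof (rule sum_mono)
      fix z assume "z \<in> F"
      then have "1 \<le> c z" using F by (auto simp: T_def)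
      then have "(of_nat 1 :: ennreal) \<le> of_nat (c z)" by (rule of_nat_mono)
      then show "(1 :: ennreal) \<le> of_nat (c z)" by simp
    qed
    also have "\<dots> = (\<Sum>\<^sub>\<infinity>z\<in>F. of_nat (c z))" using F by simp
    also have "\<dots> \<le> (\<Sum>\<^sub>\<infinity>z\<in>S. of_nat (c z))"
      by (rule infsum_mono_neutral[OF summ summ]) (use F in \<open>auto simp: T_def\<close>)
    also have "\<dots> = of_nat n" using assms by (simp add: point_count_def)
    finally show ?thesis by simp
  qed
  have finT: "finite T"
    using card_le by (metis infinite_arbitrarily_large not_less_eq_eq order_refl)
  have "of_nat n = (\<Sum>\<^sub>\<infinity>z\<in>T. of_nat (c z) :: ennreal)"
    unfolding assms[symmetric] point_count_def
    by (rule infsum_cong_neutral) (auto simp: T_def)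
  also have "\<dots> = of_nat (\<Sum>z\<in>T. c z)" using finT by simp
  finally have n: "n = (\<Sum>z\<in>T. c z)" using of_nat_eq_iff by blast
  define M where "M = (\<Sum>z\<in>T. replicate_mset (c z) z)"
  have cnt: "count M z = (if z \<in> T then c z else 0)" for z
    unfolding M_def count_sum using finT by (simp add: sum.delta if_distrib cong: if_cong)
  have sz: "size M = n" unfolding M_def n by (simp add: size_multiset_sum)
  obtain xs where xs: "mset xs = M" using ex_mset by blast
  have len: "length xs = n" using xs sz by (metis size_mset)
  define p where "p j = xs ! (j - 1)" for j :: nat
  have inS: "p j \<in> S" if "j \<in> {1..n}" for j
  proof -
    have "p j \<in> set xs" using that len by (auto simp: p_def)
    then have "count M (p j) \<noteq> 0" using xs by (metis count_eq_zero_iff set_mset_mset)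
    then show ?thesis using cnt by (auto simp: T_def split: if_splits)
  qed
  have "card {j\<in>{1..n}. p j = z} = c z" if "z \<in> S" for z
  proof -
    have "{j\<in>{1..n}. p j = z} = Suc ` {i. i < length xs \<and> xs ! i = z}"
    proof (intro set_eqI iffI)
      fix j assume "j \<in> {j\<in>{1..n}. p j = z}"
      then show "j \<in> Suc ` {i. i < length xs \<and> xs ! i = z}"
        using len by (intro image_eqI[of _ _ "j - 1"]) (auto simp: p_def)
    qed (use len in \<open>auto simp: p_def\<close>)
    then have "card {j\<in>{1..n}. p j = z} = card {i. i < length xs \<and> xs ! i = z}"
      by (simp add: card_image)
    also have "\<dots> = count M z"
      by (simp add: xs[symmetric] count_mset count_list_eq_length_filter length_filter_conv_card eq_commute)
    also have "\<dots> = c z" using that by (auto simp: cnt T_def)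
    finally show ?thesis .
  qed
  then have "lists_points c S n (fst \<circ> p) (snd \<circ> p)"
    using inS by (simp add: lists_points_def)
  then show ?thesis by blast
qed

section \<open>Poisson shot noise\<close>

definition mark_support :: "('m \<Rightarrow> 'a::euclidean_space \<Rightarrow> real) \<Rightarrow> 'm \<Rightarrow> 'a set" where
  "mark_support g m = closure {x. g m x > 0}"

definition shot_noise ::
  "('m \<Rightarrow> 'a::euclidean_space \<Rightarrow> real) \<Rightarrow> ('a \<times> 'm \<Rightarrow> nat) \<Rightarrow> 'a \<Rightarrow> ennreal" where
  "shot_noise g c y = (\<Sum>\<^sub>\<infinity>z. of_nat (c z) * ennreal (g (snd z) (y - fst z)))"

definition excursion_set ::
  "('m \<Rightarrow> 'a::euclidean_space \<Rightarrow> real) \<Rightarrow> ('a \<times> 'm \<Rightarrow> nat) \<Rightarrow> real \<Rightarrow> 'a set" where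
  "excursion_set g c u = {y. shot_noise g c y \<ge> ennreal u}"

definition window :: "'a::euclidean_space set \<Rightarrow> real \<Rightarrow> 'a set" where
  "window W r = (\<lambda>y. r *\<^sub>R y) ` W"

definition hitting_set ::
  "'m measure \<Rightarrow> ('m \<Rightarrow> 'a::euclidean_space \<Rightarrow> real) \<Rightarrow> 'a set \<Rightarrow> ('a \<times> 'm) set" where
  "hitting_set Q g A =
     {(x, m). m \<in> space Q \<and> (\<lambda>z. z + x) ` mark_support g m \<inter> A \<noteq> {}}"

definition excursion_piece ::
  "('m \<Rightarrow> 'a::euclidean_space \<Rightarrow> real) \<Rightarrow> 'a set \<Rightarrow> real \<Rightarrow> (nat \<Rightarrow> 'a) \<Rightarrow> (nat \<Rightarrow> 'm) \<Rightarrow> nat set \<Rightarrow> 'a set"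
  where
  "excursion_piece g A u x m I =
     {y\<in>A. (\<Sum>j\<in>I. g (m j) (y - x j)) \<ge> u \<and>
           (\<forall>j\<in>I. y \<in> (\<lambda>z. z + x j) ` mark_support g (m j))}"

end

theory Submission
  imports Defs
begin

text \<open>
  The geometric part is elementary. If only finitely many grains \<open>K\<^sub>m + x\<close> meet the window, then on the
  window the shot noise is a finite sum of nonnegative functions, since a point of the process contributes
  nothing outside its grain (\<open>shot_noise_eq_finite_sum\<close>). A point of the window
  lies in the excursion set exactly if the sum over the grains covering it is at least \<open>u\<close>, which
  gives the union (\<open>excursion_set_eq_Union_pieces\<close>). On the intersection of the window with the grains
  of a set \<open>I\<close> of indices the sum is continuous and concave, so each piece is compact and convex
  (\<open>compact_convex_excursion_piece\<close>).

  The substance is the almost sure finiteness of the number of grains that hit the window. It holds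
  for any set contained in a measurable set of finite intensity (\<open>poisson_process_AE_finite\<close>). Such a
  cover of the hitting set is a countable union of measurable rectangles, whose intensity is at
  most \<open>\<gamma>\<close> times the integral over \<open>m\<close> of the volume of \<open>K\<^sub>m + \<rho> B\<close> for a fixed \<open>\<rho>\<close>
  (\<open>hitting_set_cover\<close>). By the Steiner formula this volume is a combination with nonnegative
  coefficients of the intrinsic volumes of \<open>K\<^sub>m\<close>; those with index \<open>1, \<dots>, d\<close> are integrable
  by assumption, and the one with index \<open>0\<close> is at most \<open>1\<close> (\<open>intrinsic_volume_0_le_1\<close>).

  The intrinsic volumes are defined as the coefficients in the Steiner formula, so the formula has to
  be established (\<open>steiner_formula\<close>). For a polytope \<open>P\<close> with metric projection \<open>p\<close>, sort the
  points \<open>x\<close> of the space by the set of vertices \<open>w\<close> with \<open>(x - p x) \<bullet> (w - p x) = 0\<close>.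
  On each of these finitely many pieces the map \<open>x \<mapsto> p x + s (x - p x)\<close> is affine: it fixes an
  affine subspace and scales the directions orthogonal to it by \<open>s\<close>. The volume of the part of the piece within
  distance \<open>s\<close> of \<open>P\<close> is therefore a polynomial in \<open>s\<close> of degree at most \<open>d\<close>
  (\<open>measure_steiner_piece_poly\<close>), and so is the volume of \<open>P + s B\<close>. A compact convex set is
  approximated by inscribed polytopes, and pointwise limits of polynomials of bounded
  degree are polynomials (\<open>pointwise_limit_of_polys\<close>).
\<close>

section \<open>Limits of polynomials of bounded degree\<close>

definition lagrange_basis :: "nat \<Rightarrow> nat \<Rightarrow> real poly" where
  "lagrange_basis d i = (\<Prod>j\<in>{..d} - {i}. smult (1 / (real i - real j)) [:- real j, 1:])"

lemma degree_lagrange_basis: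
  assumes "i \<le> d" shows "degree (lagrange_basis d i) \<le> d"
proof -
  have "degree (lagrange_basis d i)
      \<le> (\<Sum>j\<in>{..d} - {i}. degree (smult (1 / (real i - real j)) [:- real j, 1:]))"
    unfolding lagrange_basis_def using degree_prod_sum_le by (metis (no_types, lifting) comp_def finite_Diff finite_atMost sum.cong)
  also have "\<dots> \<le> (\<Sum>j\<in>{..d} - {i}. 1)"
    by (intro sum_mono order_trans[OF degree_smult_le]) simp
  also have "\<dots> = d" using assms by simp
  finally show ?thesis .
qed

lemma poly_lagrange_basis:
  assumes "i \<le> d" "k \<le> d"
  shows "poly (lagrange_basis d i) (real k) = (if k = i then 1 else 0)"
proof (cases "k = i")
  case True
  have "poly (smult (1 / (real i - real j)) [:- real j, 1:]) (real i) = 1" if "j \<noteq> i" for j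
  proof -
    have "real i - real j \<noteq> 0" using that by simp
    then show ?thesis by (simp flip: diff_divide_distrib)
  qed
  then show ?thesis using True
    unfolding lagrange_basis_def poly_prod by (intro trans[OF prod.neutral]) auto
next
  case False
  then show ?thesis using assms by (auto simp: lagrange_basis_def poly_prod intro!: prod_zero bexI[of _ k])
qed

text \<open>
  Both sides have degree at most \<open>d\<close> and agree at the \<open>d + 1\<close> nodes \<open>0, \<dots>, d\<close>.
\<close>

lemma lagrange_interpolation:
  assumes "degree p \<le> d"
  shows "p = (\<Sum>i\<le>d. smult (poly p (real i)) (lagrange_basis d i))"
proof (rule poly_eqI_degree[where A = "real ` {..d}"])
  fix x assume "x \<in> real ` {..d}"
  then obtain k where k: "x = real k" "k \<le> d" by auto
  have "(\<Sum>i\<le>d. poly p (real i) * poly (lagrange_basis d i) (real k))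
      = (\<Sum>i\<le>d. if k = i then poly p (real i) else 0)"
    by (intro sum.cong) (use k in \<open>auto simp: poly_lagrange_basis\<close>)
  also have "\<dots> = poly p x" using k by simp
  finally show "poly p x = poly (\<Sum>i\<le>d. smult (poly p (real i)) (lagrange_basis d i)) x"
    using k by (simp add: poly_sum)
next
  have "card (real ` {..d}) = Suc d" by (simp add: card_image)
  moreover have "degree (\<Sum>i\<le>d. smult (poly p (real i)) (lagrange_basis d i)) \<le> d"
    by (intro degree_sum_le) (auto intro!: order_trans[OF degree_smult_le] degree_lagrange_basis)
  ultimately show "degree p < card (real ` {..d})"
     "degree (\<Sum>i\<le>d. smult (poly p (real i)) (lagrange_basis d i)) < card (real ` {..d})"
    using assms by auto
qed

text \<open>
  A polynomial of degree at most \<open>d\<close> is a fixed linear combination of the Lagrange basis whose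
  coefficients are its values at \<open>0, \<dots>, d\<close>; such a representation passes to pointwise limits.
  This is how the Steiner formula is carried from polytopes to all convex bodies.
\<close>

lemma pointwise_limit_of_polys:
  fixes p :: "nat \<Rightarrow> real poly"
  assumes deg: "\<And>n. degree (p n) \<le> d"
    and lim: "\<And>t. t \<ge> 0 \<Longrightarrow> (\<lambda>n. poly (p n) t) \<longlonglongrightarrow> f t"
  shows "\<exists>q. degree q \<le> d \<and> (\<forall>t\<ge>0. poly q t = f t)"
proof (intro exI conjI allI impI)
  let ?q = "\<Sum>i\<le>d. smult (f (real i)) (lagrange_basis d i)"
  show "degree ?q \<le> d"
    by (intro degree_sum_le) (auto intro!: order_trans[OF degree_smult_le] degree_lagrange_basis)
  fix t :: real assume t: "t \<ge> 0"
  have "(\<lambda>n. \<Sum>i\<le>d. poly (p n) (real i) * poly (lagrange_basis d i) t)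
      \<longlonglongrightarrow> (\<Sum>i\<le>d. f (real i) * poly (lagrange_basis d i) t)"
    by (intro tendsto_intros lim) simp
  moreover have "poly (p n) t = (\<Sum>i\<le>d. poly (p n) (real i) * poly (lagrange_basis d i) t)" for n
    by (subst lagrange_interpolation[OF deg]) (simp add: poly_sum)
  ultimately have "(\<lambda>n. poly (p n) t) \<longlonglongrightarrow> poly ?q t" by (simp add: poly_sum)
  then show "poly ?q t = f t" using lim[OF t] LIMSEQ_unique by blast
qed

section \<open>Parallel bodies\<close>

lemma parallel_body_eq_sums: "parallel_body K t = {x + y |x y. x \<in> K \<and> y \<in> cball 0 t}"
proof (intro set_eqI iffI)
  fix z assume "z \<in> parallel_body K t"
  then obtain x where "x \<in> K" "dist x z \<le> t" by (auto simp: parallel_body_def)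
  then show "z \<in> {x + y |x y. x \<in> K \<and> y \<in> cball 0 t}"
    by (intro CollectI exI[of _ x] exI[of _ "z - x"]) (simp add: dist_norm norm_minus_commute)
qed (auto simp: parallel_body_def dist_norm intro!: bexI)

lemma compact_parallel_body: "compact K \<Longrightarrow> compact (parallel_body K t)"
  unfolding parallel_body_eq_sums by (rule compact_sums) auto

lemma convex_parallel_body: "convex K \<Longrightarrow> convex (parallel_body K t)"
proof -
  assume "convex K"
  moreover have "parallel_body K t = (\<Union>x\<in>K. \<Union>y\<in>cball 0 t. {x + y})"
    unfolding parallel_body_eq_sums by (rule set_eqI) (simp only: mem_Collect_eq UN_iff singleton_iff Bex_def, blast)
  ultimately show ?thesis by (simp add: convex_sums)
qed

lemma parallel_body_mono: "K \<subseteq> L \<Longrightarrow> s \<le> t \<Longrightarrow> parallel_body K s \<subseteq> parallel_body L t"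
  unfolding parallel_body_def by (intro UN_mono cball_subset_cball_iff[THEN iffD2]) auto

lemma parallel_body_parallel_body_subset:
  "parallel_body (parallel_body K s) t \<subseteq> parallel_body K (s + t)"
proof
  fix z assume "z \<in> parallel_body (parallel_body K s) t"
  then obtain x y where "x \<in> K" "dist x y \<le> s" "dist y z \<le> t" by (auto simp: parallel_body_def)
  moreover have "dist x z \<le> dist x y + dist y z" by (rule dist_triangle)
  ultimately show "z \<in> parallel_body K (s + t)"
    by (auto simp: parallel_body_def intro!: bexI[of _ x])
qed

text \<open>
  The distance from \<open>x\<close> to a closed set is attained at the metric projection of \<open>x\<close>.
\<close>

lemma parallel_body_closest_point:
  assumes "closed K" "K \<noteq> {}"
  shows "parallel_body K t = {x. dist x (closest_point K x) \<le> t}"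
proof (intro set_eqI iffI)
  fix z assume "z \<in> parallel_body K t"
  then obtain x where "x \<in> K" "dist x z \<le> t" by (auto simp: parallel_body_def)
  then show "z \<in> {x. dist x (closest_point K x) \<le> t}"
    using closest_point_le[OF assms(1), of x z] by (simp add: dist_commute)
next
  fix z assume "z \<in> {x. dist x (closest_point K x) \<le> t}"
  then show "z \<in> parallel_body K t"
    using closest_point_in_set[OF assms, of z] by (auto simp: parallel_body_def dist_commute)
qed

lemma lmeasurable_parallel_body:
  fixes K :: "'a::euclidean_space set"
  shows "compact K \<Longrightarrow> parallel_body K t \<in> lmeasurable"
  by (simp add: compact_parallel_body lmeasurable_compact)

lemma measure_lborel_compact:
  fixes K :: "'a::euclidean_space set"
  shows "compact K \<Longrightarrow> measure lborel K = measure lebesgue K"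
  by (simp add: measure_completion borel_compact)

section \<open>Dilating the orthogonal complement of a subspace\<close>

text \<open>
  For an orthonormal set \<open>B\<close> this is the identity on the span of \<open>B\<close> and multiplication by \<open>s\<close> on
  its orthogonal complement: the sum is the orthogonal projection of \<open>y\<close> onto the span.
\<close>

definition dilate_complement :: "'a::euclidean_space set \<Rightarrow> real \<Rightarrow> 'a \<Rightarrow> 'a" where
  "dilate_complement B s y = s *\<^sub>R y + (1 - s) *\<^sub>R (\<Sum>b\<in>B. (y \<bullet> b) *\<^sub>R b)"

lemma linear_dilate_complement: "linear (dilate_complement B s)"
  unfolding dilate_complement_def
  by (intro linearI)
     (simp_all add: algebra_simps inner_add_left sum.distrib scaleR_sum_right)

lemma dilate_complement_on:
  assumes B: "pairwise orthogonal B" "\<And>b. b \<in> B \<Longrightarrow> norm b = 1" "finite B"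
    and p: "p \<in> span B" and v: "\<And>b. b \<in> B \<Longrightarrow> v \<bullet> b = 0"
  shows "dilate_complement B s (p + v) = p + s *\<^sub>R v"
proof -
  have "(\<Sum>b\<in>B. ((p + v) \<bullet> b) *\<^sub>R b) = (\<Sum>b\<in>B. (p \<bullet> b) *\<^sub>R b)"
    by (intro sum.cong) (auto simp: inner_add_left v)
  also have "\<dots> = p" by (rule orthonormal_basis_expand) (use B p in auto)
  finally show ?thesis by (simp add: dilate_complement_def algebra_simps)
qed

lemma dilate_complement_compose:
  assumes B: "pairwise orthogonal B" "\<And>b. b \<in> B \<Longrightarrow> norm b = 1" "finite B"
  shows "dilate_complement B s \<circ> dilate_complement B t = dilate_complement B (s * t)"
proof
  fix y
  define p where "p = (\<Sum>b\<in>B. (y \<bullet> b) *\<^sub>R b)"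
  have p: "p \<in> span B" unfolding p_def by (intro span_sum span_scale span_base)
  have v: "(y - p) \<bullet> b = 0" if "b \<in> B" for b
  proof -
    have "p \<bullet> b = (\<Sum>c\<in>B. (y \<bullet> c) * (c \<bullet> b))" by (simp add: p_def inner_sum_left)
    also have "\<dots> = (\<Sum>c\<in>B. if c = b then y \<bullet> b else 0)"
    proof (intro sum.cong refl)
      fix c assume "c \<in> B"
      then show "(y \<bullet> c) * (c \<bullet> b) = (if c = b then y \<bullet> b else 0)"
        using B(1) B(2)[of b] that
        by (auto simp: pairwise_def orthogonal_def dot_square_norm)
    qed
    also have "\<dots> = y \<bullet> b" using that B(3) by simp
    finally show ?thesis by (simp add: inner_diff_left)
  qed
  have eq: "dilate_complement B r (p + x *\<^sub>R (y - p)) = p + r *\<^sub>R x *\<^sub>R (y - p)" for r x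
    by (rule dilate_complement_on[OF B p]) (auto simp: v)
  show "(dilate_complement B s \<circ> dilate_complement B t) y = dilate_complement B (s * t) y"
    using eq[of t 1] eq[of s t] eq[of "s * t" 1] by simp
qed

text \<open>
  The dilation by \<open>s\<close> is the square of the dilation by \<open>sqrt s\<close>, so its determinant is a square.
  This spares the computation of the determinant as a power of \<open>s\<close>.
\<close>

lemma det_dilate_complement_nonneg:
  fixes B :: "(real ^ 'n) set"
  assumes B: "pairwise orthogonal B" "\<And>b. b \<in> B \<Longrightarrow> norm b = 1" "finite B" and "s \<ge> 0"
  shows "det (matrix (dilate_complement B s)) \<ge> 0"
proof -
  have "dilate_complement B s = dilate_complement B (sqrt s) \<circ> dilate_complement B (sqrt s)"
    using assms(4) by (simp add: dilate_complement_compose[OF B])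
  then have "det (matrix (dilate_complement B s)) = det (matrix (dilate_complement B (sqrt s))) ^ 2"
    by (simp add: matrix_compose linear_dilate_complement det_mul power2_eq_square)
  then show ?thesis by simp
qed

text \<open>
  The matrix entries are affine functions of \<open>s\<close>, so the Leibniz formula gives a polynomial whose
  degree is at most the size of the matrix.
\<close>

lemma det_dilate_complement_poly:
  fixes B :: "(real ^ 'n) set"
  shows "\<exists>q. degree q \<le> CARD('n) \<and> (\<forall>s. poly q s = det (matrix (dilate_complement B s)))"
proof (intro exI conjI allI)
  define P :: "'n \<Rightarrow> 'n \<Rightarrow> real" where "P i j = (\<Sum>b\<in>B. (axis j 1 \<bullet> b) *\<^sub>R b) $ i" for i j
  define E :: "'n \<Rightarrow> 'n \<Rightarrow> real poly"
    where "E i j = [:P i j, axis j 1 $ i - P i j:]" for i j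
  let ?q = "\<Sum>p\<in>{p. p permutes (UNIV :: 'n set)}. smult (of_int (sign p)) (\<Prod>i\<in>UNIV. E i (p i))"
  have E: "poly (E i j) s = matrix (dilate_complement B s) $ i $ j" for i j s
    by (simp add: E_def P_def matrix_def dilate_complement_def algebra_simps)
  show "poly ?q s = det (matrix (dilate_complement B s))" for s
    by (simp add: det_def poly_sum poly_prod E)
  show "degree ?q \<le> CARD('n)"
  proof (intro degree_sum_le order_trans[OF degree_smult_le])
    fix p :: "'n \<Rightarrow> 'n"
    have "degree (\<Prod>i\<in>UNIV. E i (p i)) \<le> (\<Sum>i\<in>UNIV. degree (E i (p i)))"
      using degree_prod_sum_le[of UNIV "\<lambda>i. E i (p i)"] by (simp add: comp_def)
    also have "\<dots> \<le> (\<Sum>i\<in>(UNIV :: 'n set). 1)" by (intro sum_mono) (simp add: E_def)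
    finally show "degree (\<Prod>i\<in>UNIV. E i (p i)) \<le> CARD('n)" by simp
  qed (simp add: finite_permutations)
qed

section \<open>The Steiner formula for polytopes\<close>

text \<open>
  The generating points lying in the supporting hyperplane of the polytope at the projection \<open>p\<close> of \<open>x\<close>
  with normal vector \<open>x - p\<close>. They span a face that contains \<open>p\<close>. Sorting points by this
  set of points, rather than by the face with \<open>p\<close> in its relative interior, avoids the facial
  structure of polytopes altogether.
\<close>

definition active_set :: "'a::euclidean_space set \<Rightarrow> 'a \<Rightarrow> 'a set" where
  "active_set V x = (let p = closest_point (convex hull V) x in {w\<in>V. (x - p) \<bullet> (w - p) = 0})"

definition steiner_piece :: "'a::euclidean_space set \<Rightarrow> 'a set \<Rightarrow> real \<Rightarrow> 'a set" where
  "steiner_piece V S t = {x. dist x (closest_point (convex hull V) x) \<le> t \<and> active_set V x = S}"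

context
  fixes V :: "'a::euclidean_space set" and c :: "'a \<Rightarrow> 'a"
  assumes V: "finite V" "V \<noteq> {}"
  defines "c \<equiv> closest_point (convex hull V)"
begin

lemma convex_hull_finite_facts: "compact (convex hull V)" "closed (convex hull V)" "convex (convex hull V)" "convex hull V \<noteq> {}"
  using V by (auto simp: finite_imp_compact_convex_hull compact_imp_closed)

lemma closest_point_in_convex_hull: "c x \<in> convex hull V"
  unfolding c_def by (rule closest_point_in_set[OF convex_hull_finite_facts(2,4)])

lemma active_set_alt: "active_set V x = {w\<in>V. (x - c x) \<bullet> (w - c x) = 0}"
  by (simp add: active_set_def c_def Let_def)

text \<open>
  Write \<open>p\<close>, the projection of \<open>x\<close>, as a convex combination of the points \<open>w\<close> of \<open>V\<close>. The weighted mean of the numbers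
  \<open>(x - p) \<bullet> (w - p)\<close> is \<open>(x - p) \<bullet> (p - p) = 0\<close>, and none of them is positive, so every \<open>w\<close>
  of positive weight is active.
\<close>

lemma closest_point_in_active_hull: "c x \<in> convex hull (active_set V x)"
proof -
  obtain l where l: "\<And>w. w \<in> V \<Longrightarrow> l w \<ge> 0" "sum l V = 1" "(\<Sum>w\<in>V. l w *\<^sub>R w) = c x"
    using closest_point_in_convex_hull[of x] unfolding convex_hull_finite[OF V(1)] by auto
  have "(\<Sum>w\<in>V. l w * - ((x - c x) \<bullet> (w - c x))) = - ((x - c x) \<bullet> (\<Sum>w\<in>V. l w *\<^sub>R (w - c x)))"
    by (simp add: inner_sum_right sum_negf)
  also have "(\<Sum>w\<in>V. l w *\<^sub>R (w - c x)) = 0"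
    by (simp add: scaleR_diff_right sum_subtractf l flip: scaleR_left.sum)
  finally have z: "(\<Sum>w\<in>V. l w * - ((x - c x) \<bullet> (w - c x))) = 0" by simp
  have np: "(x - c x) \<bullet> (w - c x) \<le> 0" if "w \<in> V" for w
    unfolding c_def by (rule closest_point_dot[OF convex_hull_finite_facts(3,2)]) (simp add: hull_inc that)
  have "\<forall>w\<in>V. l w * - ((x - c x) \<bullet> (w - c x)) = 0"
    using z np l(1) by (subst sum_nonneg_eq_0_iff[symmetric]) (auto simp: V mult_nonneg_nonpos)
  then have l0: "l w = 0" if "w \<in> V - active_set V x" for w
    using that by (auto simp: active_set_alt)
  have sub: "active_set V x \<subseteq> V" by (auto simp: active_set_alt)
  have "sum l V = sum l (active_set V x)"
    by (rule sum.mono_neutral_right) (use V(1) sub l0 in auto)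
  moreover have "(\<Sum>w\<in>V. l w *\<^sub>R w) = (\<Sum>w\<in>active_set V x. l w *\<^sub>R w)"
    by (rule sum.mono_neutral_right) (use V(1) sub l0 in auto)
  ultimately have "sum l (active_set V x) = 1" "(\<Sum>w\<in>active_set V x. l w *\<^sub>R w) = c x"
    using l(2,3) by simp_all
  then show ?thesis
    unfolding convex_hull_finite[OF finite_subset[OF sub V(1)]] using l(1) sub by blast
qed

text \<open>
  All points of the ray from \<open>p\<close> through \<open>x\<close> project to \<open>p\<close>, since \<open>x - p\<close> is an outer
  normal vector of the polytope at \<open>p\<close>.
\<close>

lemma closest_point_slide:
  assumes "s \<ge> 0"
  shows "c (c x + s *\<^sub>R (x - c x)) = c x"
proof -
  let ?y = "c x + s *\<^sub>R (x - c x)"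
  have norm_sq: "(norm (a - b))\<^sup>2 = (norm a)\<^sup>2 + (norm b)\<^sup>2 - 2 * (a \<bullet> b)" for a b :: 'a
    by (simp add: power2_norm_eq_inner inner_diff_left inner_diff_right inner_commute)
  have "dist ?y (c x) \<le> dist ?y z" if z: "z \<in> convex hull V" for z
  proof -
    have np: "(x - c x) \<bullet> (z - c x) \<le> 0"
      unfolding c_def by (rule closest_point_dot[OF convex_hull_finite_facts(3,2) z])
    have "(dist ?y z)\<^sup>2 = (norm (s *\<^sub>R (x - c x) - (z - c x)))\<^sup>2" by (simp add: dist_norm algebra_simps)
    also have "\<dots> = (norm (s *\<^sub>R (x - c x)))\<^sup>2 + (norm (z - c x))\<^sup>2 - 2 * (s * ((x - c x) \<bullet> (z - c x)))"
      using norm_sq[of "s *\<^sub>R (x - c x)" "z - c x"] by simp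
    also have "\<dots> \<ge> (norm (s *\<^sub>R (x - c x)))\<^sup>2"
      using mult_nonneg_nonpos[OF assms np] zero_le_power2[of "norm (z - c x)"] by linarith
    also have "(norm (s *\<^sub>R (x - c x)))\<^sup>2 = (dist ?y (c x))\<^sup>2" by (simp add: dist_norm)
    finally show ?thesis by (rule power2_le_imp_le) simp
  qed
  then show ?thesis
    using closest_point_unique[OF convex_hull_finite_facts(3,2) closest_point_in_convex_hull] unfolding c_def by metis
qed

lemma active_set_slide:
  assumes "s > 0"
  shows "active_set V (c x + s *\<^sub>R (x - c x)) = active_set V x"
  using assms by (simp add: active_set_alt closest_point_slide)

text \<open>
  Sliding points along their projection rays scales the distance to the polytope and
  preserves the active set, hence maps one piece onto the other, with the slide by \<open>1 / s\<close> as inverse.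
\<close>

lemma steiner_piece_slide:
  assumes "s > 0"
  shows "steiner_piece V S s = (\<lambda>x. c x + s *\<^sub>R (x - c x)) ` steiner_piece V S 1"
proof (intro set_eqI iffI)
  fix y assume y: "y \<in> steiner_piece V S s"
  let ?x = "c y + (1 / s) *\<^sub>R (y - c y)"
  have cx: "c ?x = c y" using assms by (simp add: closest_point_slide)
  have "y = c ?x + s *\<^sub>R (?x - c ?x)" unfolding cx using assms by simp
  moreover have "?x \<in> steiner_piece V S 1"
    using y assms active_set_slide[of "1 / s" y] cx
    by (simp add: steiner_piece_def c_def[symmetric] dist_norm)
  ultimately show "y \<in> (\<lambda>x. c x + s *\<^sub>R (x - c x)) ` steiner_piece V S 1" by blast
next
  fix y assume "y \<in> (\<lambda>x. c x + s *\<^sub>R (x - c x)) ` steiner_piece V S 1"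
  then obtain x where "y = c x + s *\<^sub>R (x - c x)" "x \<in> steiner_piece V S 1" by blast
  then show "y \<in> steiner_piece V S s"
    using assms active_set_slide[of s x]
    by (simp add: steiner_piece_def c_def[symmetric] dist_norm closest_point_slide)
qed

text \<open>
  On one piece the sliding map is affine: \<open>c x\<close> stays in the affine hull of the active set \<open>S\<close>,
  while \<open>x - c x\<close> is orthogonal to that affine hull, and only this second part is scaled.
\<close>

lemma steiner_piece_affine:
  assumes a: "a \<in> S" and B: "\<And>b. b \<in> B \<Longrightarrow> b \<in> span {w - a |w. w \<in> S}"
    "{w - a |w. w \<in> S} \<subseteq> span B"
    "pairwise orthogonal B" "\<And>b. b \<in> B \<Longrightarrow> norm b = 1" "finite B"
    and x: "x \<in> steiner_piece V S t"
  shows "c x + s *\<^sub>R (x - c x) = a + dilate_complement B s (x - a)"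
proof -
  have S: "S = active_set V x" using x by (simp add: steiner_piece_def)
  have o: "(x - c x) \<bullet> (w - a) = 0" if "w \<in> S" for w
  proof -
    have "w - a = (w - c x) - (a - c x)" by simp
    then show ?thesis using that a unfolding S active_set_alt by (simp add: inner_diff_right)
  qed
  have "(x - c x) \<bullet> b = 0" if "b \<in> span {w - a |w. w \<in> S}" for b
    using that by (induction rule: span_induct_alt) (auto simp: o inner_add_right)
  then have v: "(x - c x) \<bullet> b = 0" if "b \<in> B" for b using B(1) that by blast
  have "c x \<in> affine hull S" 
    using closest_point_in_active_hull[of x] convex_hull_subset_affine_hull unfolding S by blast
  then obtain z where z: "c x = a + z" "z \<in> span ((\<lambda>x. - a + x) ` (S - {a}))"
    unfolding affine_hull_span2[OF a] by blast
  have "(\<lambda>x. - a + x) ` (S - {a}) \<subseteq> {w - a |w. w \<in> S}" by auto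
  then have "c x - a \<in> span {w - a |w. w \<in> S}"
    using subsetD[OF span_mono z(2)] z(1) by simp
  then have p: "c x - a \<in> span B"
    using subsetD[OF span_minimal[OF B(2) subspace_span]] by blast
  have "dilate_complement B s ((c x - a) + (x - c x)) = (c x - a) + s *\<^sub>R (x - c x)"
    by (rule dilate_complement_on) (use B(3-) p v in auto)
  then show ?thesis by simp
qed

lemma continuous_on_closest_point_hull: "continuous_on A c"
  unfolding c_def by (rule continuous_on_closest_point[OF convex_hull_finite_facts(3,2,4)])

lemma borel_steiner_piece: "steiner_piece V S t \<in> sets borel"
proof -
  have [measurable]: "c \<in> borel_measurable borel"
    by (rule borel_measurable_continuous_onI[OF continuous_on_closest_point_hull])
  have "steiner_piece V S t = (if S \<subseteq> V then {x \<in> space borel. dist x (c x) \<le> t \<and>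
      (\<forall>w\<in>S. (x - c x) \<bullet> (w - c x) = 0) \<and> (\<forall>w\<in>V - S. (x - c x) \<bullet> (w - c x) \<noteq> 0)} else {})"
    by (auto simp: steiner_piece_def active_set_alt c_def[symmetric])
  also have "\<dots> \<in> sets borel"
  proof (cases "S \<subseteq> V")
    case True
    then have [simp]: "finite S" "finite (V - S)" using V finite_subset by auto
    show ?thesis using True by simp measurable
  qed simp
  finally show ?thesis .
qed

lemma parallel_hull_eq_Union_steiner_pieces:
  "parallel_body (convex hull V) t = (\<Union>S\<in>Pow V. steiner_piece V S t)"
proof -
  have "active_set V x \<in> Pow V" for x by (auto simp: active_set_alt)
  then show ?thesis
    unfolding parallel_body_closest_point[OF convex_hull_finite_facts(2,4)] steiner_piece_def by blast
qed

lemma lmeasurable_steiner_piece: "steiner_piece V S t \<in> lmeasurable"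
proof -
  have "steiner_piece V S t \<subseteq> parallel_body (convex hull V) t"
    unfolding parallel_body_closest_point[OF convex_hull_finite_facts(2,4)]
    by (auto simp: steiner_piece_def)
  then have "bounded (steiner_piece V S t)"
    using compact_parallel_body[OF convex_hull_finite_facts(1)] bounded_subset compact_imp_bounded by metis
  then show ?thesis using borel_steiner_piece
    by (simp add: bounded_set_imp_lmeasurable)
qed

lemma empty_steiner_piece: "steiner_piece V {} t = {}"
proof -
  have "active_set V x \<noteq> {}" for x
    using closest_point_in_active_hull[of x] by auto
  then show ?thesis by (simp add: steiner_piece_def)
qed

end

text \<open>
  The piece at distance \<open>s\<close> is the image of the piece at distance \<open>1\<close> under an affine map
  whose determinant is a polynomial in \<open>s\<close>.
\<close>

lemma measure_steiner_piece_poly: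
  fixes V :: "(real ^ 'n::{finite,wellorder}) set"
  assumes V: "finite V" "V \<noteq> {}"
  shows "\<exists>q. degree q \<le> CARD('n) \<and> (\<forall>s>0. measure lebesgue (steiner_piece V S s) = poly q s)"
proof (cases "S = {}")
  case True
  then show ?thesis using empty_steiner_piece[OF V] by (intro exI[of _ 0]) simp
next
  case False
  then obtain a where a: "a \<in> S" by blast
  let ?U = "span {w - a |w. w \<in> S}"
  obtain B where B: "B \<subseteq> ?U" "pairwise orthogonal B" "\<And>b. b \<in> B \<Longrightarrow> norm b = 1" "independent B"
      "span B = ?U"
    by (rule orthonormal_basis_subspace[of ?U]) (auto simp: subspace_span)
  have finB: "finite B" using B(4) by (rule independent_imp_finite)
  let ?c = "closest_point (convex hull V)"
  let ?A = "steiner_piece V S 1"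
  let ?T = "dilate_complement B"
  obtain q where q: "degree q \<le> CARD('n)" "\<And>s. poly q s = det (matrix (?T s))"
    using det_dilate_complement_poly by blast
  have "measure lebesgue (steiner_piece V S s) = poly q s * measure lebesgue ?A" if s: "s > 0" for s
  proof -
    have "steiner_piece V S s = (\<lambda>x. ?c x + s *\<^sub>R (x - ?c x)) ` ?A"
      by (rule steiner_piece_slide[OF V s])
    also have "\<dots> = (\<lambda>x. a + ?T s (x - a)) ` ?A"
      by (intro image_cong refl steiner_piece_affine[OF V a])
         (use B finB in \<open>auto intro: span_base\<close>)
    also have "\<dots> = (+) a ` ?T s ` (+) (- a) ` ?A" by (simp add: image_image)
    finally have "measure lebesgue (steiner_piece V S s) = measure lebesgue (?T s ` (+) (- a) ` ?A)"
      by (simp add: measure_translation)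
    also have "\<dots> = \<bar>det (matrix (?T s))\<bar> * measure lebesgue ((+) (- a) ` ?A)"
      by (intro measure_linear_image linear_dilate_complement measurable_translation
            lmeasurable_steiner_piece V)
    also have "\<dots> = poly q s * measure lebesgue ?A"
      using det_dilate_complement_nonneg[OF B(2,3) finB, of s] s q(2)
      by (simp only: measure_translation abs_of_nonneg)
    finally show ?thesis .
  qed
  note scaling = this
  show ?thesis
  proof (intro exI conjI allI impI)
    show "degree (smult (measure lebesgue ?A) q) \<le> CARD('n)"
      by (rule order_trans[OF degree_smult_le q(1)])
    show "measure lebesgue (steiner_piece V S s) = poly (smult (measure lebesgue ?A) q) s"
      if "s > 0" for s
      unfolding scaling[OF that] by simp
  qed
qed

lemma steiner_polytope:
  fixes V :: "(real ^ 'n::{finite,wellorder}) set"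
  assumes V: "finite V" "V \<noteq> {}"
  shows "\<exists>q. degree q \<le> CARD('n) \<and>
    (\<forall>t>0. measure lebesgue (parallel_body (convex hull V) t) = poly q t)"
proof -
  have "\<exists>q. \<forall>S. degree (q S) \<le> CARD('n) \<and>
      (\<forall>t>0. measure lebesgue (steiner_piece V S t) = poly (q S) t)"
    by (rule choice) (rule allI, rule measure_steiner_piece_poly[OF V])
  then obtain q where q: "\<And>S. degree (q S) \<le> CARD('n)"
    "\<And>S t. t > 0 \<Longrightarrow> measure lebesgue (steiner_piece V S t) = poly (q S) t"
    by blast
  have "measure lebesgue (parallel_body (convex hull V) t)
      = (\<Sum>S\<in>Pow V. measure lebesgue (steiner_piece V S t))" for t
    unfolding parallel_hull_eq_Union_steiner_pieces[OF V]
  proof (rule measure_UNION')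
    show "pairwise (\<lambda>S S'. disjnt (steiner_piece V S t) (steiner_piece V S' t)) (Pow V)"
      by (auto simp: pairwise_def disjnt_def steiner_piece_def)
  qed (auto simp: V lmeasurable_steiner_piece)
  then have "\<forall>t>0. measure lebesgue (parallel_body (convex hull V) t) = poly (\<Sum>S\<in>Pow V. q S) t"
    by (simp add: poly_sum q(2))
  moreover have "degree (\<Sum>S\<in>Pow V. q S) \<le> CARD('n)"
    by (rule degree_sum_le) (simp_all add: V q(1))
  ultimately show ?thesis by blast
qed

section \<open>The Steiner formula for compact convex sets\<close>

lemma compact_finite_net:
  fixes K :: "'a::metric_space set"
  assumes "compact K" "K \<noteq> {}" "e > 0"
  obtains V where "finite V" "V \<noteq> {}" "V \<subseteq> K" "K \<subseteq> (\<Union>x\<in>V. cball x e)"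
proof -
  have "\<exists>V. finite V \<and> V \<subseteq> K \<and> K \<subseteq> (\<Union>x\<in>V. ball x e)"
    using compact_imp_seq_compact[OF assms(1), THEN seq_compact_imp_totally_bounded] assms(3) by simp
  then obtain V where V: "finite V" "V \<subseteq> K" "K \<subseteq> (\<Union>x\<in>V. ball x e)"
    by (elim exE conjE)
  show ?thesis
  proof (rule that)
    show "V \<noteq> {}" using V assms(2) by auto
    show "K \<subseteq> (\<Union>x\<in>V. cball x e)"
      using V(3) by (rule order_trans) (intro UN_mono ball_subset_cball order_refl)
  qed (use V in auto)
qed

text \<open>
  Every point at distance at most \<open>s + t\<close> is reached through the point that divides the segment
  in the ratio \<open>s : t\<close>.
\<close>

lemma parallel_body_subset_parallel_body:
  assumes "s \<ge> 0" "t \<ge> 0"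
  shows "parallel_body K (s + t) \<subseteq> parallel_body (parallel_body K s) t"
proof (cases "s + t = 0")
  case True
  then have "s = 0" "t = 0" using assms by auto
  then show ?thesis by (auto simp: parallel_body_def)
next
  case False
  then have st: "s + t > 0" using assms by simp
  show ?thesis
  proof
    fix z assume "z \<in> parallel_body K (s + t)"
    then obtain x v where z: "z = x + v" "x \<in> K" "norm v \<le> s + t"
      by (auto simp: parallel_body_eq_sums)
    define r where "r = norm v / (s + t)"
    have r: "0 \<le> r" "r \<le> 1" using z st by (auto simp: r_def)
    have *: "norm ((a / (s + t)) *\<^sub>R v) \<le> a" if "a \<ge> 0" for a
    proof -
      have "norm ((a / (s + t)) *\<^sub>R v) = r * a" using that st by (simp add: r_def)
      also have "\<dots> \<le> 1 * a" using r that by (intro mult_right_mono)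
      finally show ?thesis by simp
    qed
    let ?y = "x + (s / (s + t)) *\<^sub>R v"
    have "?y \<in> parallel_body K s"
      unfolding parallel_body_eq_sums using z(2) *[OF assms(1)]
      by (intro CollectI exI[of _ x] exI[of _ "(s / (s + t)) *\<^sub>R v"]) simp
    moreover have "z = ?y + (t / (s + t)) *\<^sub>R v"
    proof -
      have "(s / (s + t)) *\<^sub>R v + (t / (s + t)) *\<^sub>R v = ((s + t) / (s + t)) *\<^sub>R v"
        by (simp only: scaleR_left_distrib[symmetric] add_divide_distrib[symmetric])
      then show ?thesis using st z(1) by (simp add: add.assoc)
    qed
    ultimately show "z \<in> parallel_body (parallel_body K s) t"
      unfolding parallel_body_eq_sums[of _ t] using *[OF assms(2)]
      by (intro CollectI exI[of _ ?y] exI[of _ "(t / (s + t)) *\<^sub>R v"]) simp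
  qed
qed

text \<open>
  A slightly larger parallel body lies in a small neighbourhood of the compact convex set
  \<open>parallel_body K t\<close>, whose boundary is a null set, so its volume cannot jump up.
\<close>

lemma measure_parallel_body_right_continuous:
  fixes K :: "'a::euclidean_space set"
  assumes K: "compact K" "convex K" and d: "d \<longlonglongrightarrow> 0" "\<And>n. d n \<ge> (0::real)" and t: "t \<ge> 0"
  shows "(\<lambda>n. measure lebesgue (parallel_body K (t + d n)))
      \<longlonglongrightarrow> measure lebesgue (parallel_body K t)"
proof (rule LIMSEQ_I)
  fix e :: real assume e: "e > 0"
  let ?S = "parallel_body K t"
  have "bounded ?S" using compact_parallel_body[OF K(1)] compact_imp_bounded by blast
  moreover have "negligible (frontier ?S)"
    by (rule negligible_convex_frontier[OF convex_parallel_body[OF K(2)]])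
  ultimately obtain b where b: "b > 0"
    "\<And>T. \<lbrakk>T \<in> lmeasurable; \<And>y. y \<in> T \<Longrightarrow> \<exists>x. x \<in> ?S \<and> dist x y < b\<rbrakk>
        \<Longrightarrow> measure lebesgue T < measure lebesgue ?S + e"
    using measure_semicontinuous_with_hausdist_explicit[OF _ _ e] by metis
  obtain N where N: "\<And>n. n \<ge> N \<Longrightarrow> d n < b"
    using LIMSEQ_D[OF d(1) b(1)] d(2) by auto
  show "\<exists>N. \<forall>n\<ge>N. norm (measure lebesgue (parallel_body K (t + d n)) - measure lebesgue ?S) < e"
  proof (intro exI allI impI)
    fix n assume n: "n \<ge> N"
    have "measure lebesgue (parallel_body K (t + d n)) < measure lebesgue ?S + e"
    proof (rule b(2)[OF lmeasurable_parallel_body[OF K(1)]])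
      fix y assume "y \<in> parallel_body K (t + d n)"
      then have "y \<in> parallel_body ?S (d n)"
        using parallel_body_subset_parallel_body[OF t d(2)[of n]] by blast
      then show "\<exists>x. x \<in> ?S \<and> dist x y < b"
        using N[OF n] by (auto simp: parallel_body_def[of ?S])
    qed
    moreover have "measure lebesgue ?S \<le> measure lebesgue (parallel_body K (t + d n))"
      by (intro measure_mono_fmeasurable parallel_body_mono fmeasurableD lmeasurable_parallel_body K) (simp_all add: d)
    ultimately show "norm (measure lebesgue (parallel_body K (t + d n)) - measure lebesgue ?S) < e"
      by simp
  qed
qed

lemma poly_shift:
  fixes q :: "real poly"
  shows "\<exists>q'. degree q' \<le> degree q \<and> (\<forall>t. poly q' t = poly q (t + e))"
  by (intro exI[of _ "q \<circ>\<^sub>p [:e, 1:]"] conjI allI order_trans[OF degree_pcompose_le])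
     (simp_all add: poly_pcompose add.commute)

text \<open>
  Inscribe polytopes \<open>P\<^sub>n \<subseteq> K\<close> with \<open>K \<subseteq> P\<^sub>n + \<delta>\<^sub>n B\<close> and \<open>\<delta>\<^sub>n \<rightarrow> 0\<close>. Then
  \<open>K + t B \<subseteq> P\<^sub>n + (t + \<delta>\<^sub>n) B \<subseteq> K + (t + \<delta>\<^sub>n) B\<close>, and the volume in the middle is a polynomial
  in \<open>t\<close> of bounded degree. The shift by \<open>\<delta>\<^sub>n\<close> means that only right continuity of the volume is
  needed, and that \<open>t = 0\<close> is covered although the polytope formula is for positive distances.
\<close>

lemma steiner_polynomial_wellorder:
  fixes K :: "(real ^ 'n::{finite,wellorder}) set"
  assumes K: "compact K" "convex K" "K \<noteq> {}"
  shows "\<exists>q. degree q \<le> CARD('n) \<and> (\<forall>t\<ge>0. poly q t = measure lebesgue (parallel_body K t))"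
proof -
  \<comment> \<open>The mesh widths of the inscribed polytopes.\<close>
  define d where "d n = inverse (real (Suc n))" for n
  have d: "d n > 0" for n by (simp add: d_def)
  have d0: "d \<longlonglongrightarrow> 0" unfolding d_def by (rule LIMSEQ_inverse_real_of_nat)
  have "\<exists>q. degree q \<le> CARD('n) \<and> (\<forall>t\<ge>0. measure lebesgue (parallel_body K t) \<le> poly q t \<and>
      poly q t \<le> measure lebesgue (parallel_body K (t + d n)))" for n
  proof -
    obtain V where V: "finite V" "V \<noteq> {}" "V \<subseteq> K" "K \<subseteq> (\<Union>x\<in>V. cball x (d n))"
      using compact_finite_net[OF K(1,3) d] by blast
    let ?P = "convex hull V"
    have cP: "compact ?P" using V(1) by (simp add: finite_imp_compact_convex_hull)
    have PK: "?P \<subseteq> K" using V(3) K(2) by (rule hull_minimal)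
    have "K \<subseteq> parallel_body ?P (d n)"
      using V(4) hull_subset[of V convex] by (fastforce simp: parallel_body_def)
    then have KP: "parallel_body K t \<subseteq> parallel_body ?P (t + d n)" for t
      using parallel_body_parallel_body_subset[of ?P "d n" t] parallel_body_mono[of K _ t t]
      by (metis add.commute order_refl order_trans)
    obtain q where q: "degree q \<le> CARD('n)"
      "\<And>t. t > 0 \<Longrightarrow> measure lebesgue (parallel_body ?P t) = poly q t"
      using steiner_polytope[OF V(1,2)] by blast
    obtain q' where q': "degree q' \<le> degree q" "\<And>t. poly q' t = poly q (t + d n)"
      using poly_shift by blast
    have "measure lebesgue (parallel_body K t) \<le> poly q' t \<and>
        poly q' t \<le> measure lebesgue (parallel_body K (t + d n))" if t: "t \<ge> 0" for t
    proof -
      have "poly q' t = measure lebesgue (parallel_body ?P (t + d n))"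
        unfolding q'(2) using t d[of n] by (simp add: q(2) add_nonneg_pos)
      moreover have "measure lebesgue (parallel_body K t)
          \<le> measure lebesgue (parallel_body ?P (t + d n))"
        by (intro measure_mono_fmeasurable KP fmeasurableD lmeasurable_parallel_body K cP)
      moreover have "measure lebesgue (parallel_body ?P (t + d n))
          \<le> measure lebesgue (parallel_body K (t + d n))"
        by (intro measure_mono_fmeasurable parallel_body_mono PK fmeasurableD
            lmeasurable_parallel_body K cP order_refl)
      ultimately show ?thesis by simp
    qed
    then show ?thesis using q(1) q'(1) by (intro exI[of _ q']) auto
  qed
  then obtain q where q: "\<And>n. degree (q n) \<le> CARD('n)"
    "\<And>n t. t \<ge> 0 \<Longrightarrow> measure lebesgue (parallel_body K t) \<le> poly (q n) t"
    "\<And>n t. t \<ge> 0 \<Longrightarrow> poly (q n) t \<le> measure lebesgue (parallel_body K (t + d n))"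
    by metis
  show ?thesis
  proof (rule pointwise_limit_of_polys[of q])
    fix t :: real assume t: "t \<ge> 0"
    have "(\<lambda>n. measure lebesgue (parallel_body K (t + d n)))
        \<longlonglongrightarrow> measure lebesgue (parallel_body K t)"
      by (rule measure_parallel_body_right_continuous[OF K(1,2) d0 less_imp_le[OF d] t])
    then show "(\<lambda>n. poly (q n) t) \<longlonglongrightarrow> measure lebesgue (parallel_body K t)"
      by (rule tendsto_sandwich[OF _ _ tendsto_const, rotated 2])
         (use q(2,3)[OF t] in \<open>auto intro!: always_eventually\<close>)
  qed (rule q(1))
qed

text \<open>
  The linear change of variables is applied above with well-ordered coordinate indices. Any finite
  index type has a well-ordered copy, and relabelling the coordinates preserves distances and
  volumes, so that the Steiner formula holds for all finite index types.
\<close>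

typedef 'a ordered_copy = "UNIV :: 'a set" morphisms the_original Copy by simp

instance ordered_copy :: (finite) finite
proof
  have "finite (range (Copy :: 'a \<Rightarrow> 'a ordered_copy))" by simp
  then show "finite (UNIV :: 'a ordered_copy set)"
    unfolding type_definition.Abs_image[OF type_definition_ordered_copy] .
qed

instantiation ordered_copy :: (finite) wellorder
begin

definition less_eq_ordered_copy :: "'a ordered_copy \<Rightarrow> 'a ordered_copy \<Rightarrow> bool" where
  "x \<le> y \<longleftrightarrow> to_nat (the_original x) \<le> to_nat (the_original y)"

definition less_ordered_copy :: "'a ordered_copy \<Rightarrow> 'a ordered_copy \<Rightarrow> bool" where
  "x < y \<longleftrightarrow> to_nat (the_original x) < to_nat (the_original y)"

instance
proof
  fix P :: "'a ordered_copy \<Rightarrow> bool" and a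
  assume step: "\<And>x. (\<And>y. y < x \<Longrightarrow> P y) \<Longrightarrow> P x"
  show "P a"
    by (induction a rule: measure_induct_rule[of "\<lambda>x. to_nat (the_original x)"])
       (rule step, simp add: less_ordered_copy_def)
qed (auto simp: less_eq_ordered_copy_def less_ordered_copy_def the_original_inject)

end

lemma bij_the_original: "bij (the_original :: 'a ordered_copy \<Rightarrow> 'a)"
  by (intro bij_betw_byWitness[where f' = Copy])
     (auto simp: the_original_inverse Copy_inverse)

definition recoordinate :: "real ^ 'n \<Rightarrow> real ^ 'n ordered_copy" where
  "recoordinate x = (\<chi> i. x $ the_original i)"

lemma bij_recoordinate: "bij recoordinate"
  by (intro bij_betw_byWitness[where f' = "\<lambda>y. \<chi> i. y $ Copy i"])
     (auto simp: recoordinate_def the_original_inverse Copy_inverse vec_eq_iff)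

lemma linear_recoordinate: "linear (recoordinate :: real ^ 'n::finite \<Rightarrow> _)"
  by (intro linearI) (simp_all add: recoordinate_def vec_eq_iff)

lemma dist_recoordinate:
  "dist (recoordinate x) (recoordinate y) = dist x (y :: real ^ 'n::finite)"
proof -
  have "(\<Sum>i\<in>UNIV. (dist (x $ the_original i) (y $ the_original i))\<^sup>2)
      = (\<Sum>i\<in>UNIV. (dist (x $ i) (y $ i))\<^sup>2)"
    by (rule sum.reindex_bij_betw[OF bij_the_original])
  then show ?thesis by (simp add: dist_vec_def L2_set_def recoordinate_def)
qed

lemma continuous_on_recoordinate: "continuous_on A (recoordinate :: real ^ 'n::finite \<Rightarrow> _)"
  by (rule linear_continuous_on[OF linear_conv_bounded_linear[THEN iffD1, OF linear_recoordinate]])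

lemma parallel_body_recoordinate:
  fixes K :: "(real ^ 'n::finite) set"
  shows "parallel_body (recoordinate ` K) t = recoordinate ` parallel_body K t"
proof (intro set_eqI iffI)
  fix y assume "y \<in> parallel_body (recoordinate ` K) t"
  moreover obtain z where "y = recoordinate z" using bij_recoordinate by (metis bij_pointE)
  ultimately show "y \<in> recoordinate ` parallel_body K t"
    by (auto simp: parallel_body_def dist_recoordinate)
qed (auto simp: parallel_body_def dist_recoordinate)

lemma prod_Basis_cart:
  fixes f :: "real ^ 'n::finite \<Rightarrow> 'a::comm_monoid_mult"
  shows "(\<Prod>b\<in>Basis. f b) = (\<Prod>i\<in>UNIV. f (axis i 1))"
proof -
  have "(Basis :: (real ^ 'n) set) = range (\<lambda>i. axis i 1)"
    by (auto simp: Basis_vec_def)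
  moreover have "inj (\<lambda>i :: 'n. axis i (1::real))" by (auto simp: inj_on_def axis_eq_axis)
  ultimately show ?thesis using prod.reindex[of "\<lambda>i :: 'n. axis i (1::real)" UNIV f] by simp
qed

lemma distr_recoordinate:
  "distr lborel borel (recoordinate :: real ^ 'n::finite \<Rightarrow> _) = lborel"
proof (rule lborel_eqI[symmetric])
  have [measurable]: "(recoordinate :: real ^ 'n \<Rightarrow> _) \<in> borel_measurable borel"
    by (rule borel_measurable_continuous_onI[OF continuous_on_recoordinate])
  fix l u :: "real ^ 'n ordered_copy"
  assume le: "\<And>b. b \<in> Basis \<Longrightarrow> l \<bullet> b \<le> u \<bullet> b"
  have le': "l $ i \<le> u $ i" for i using le[of "axis i 1"] by (simp add: inner_axis axis_in_Basis_iff)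
  let ?l = "(\<chi> i. l $ Copy i) :: real ^ 'n" and ?u = "(\<chi> i. u $ Copy i) :: real ^ 'n"
  have "recoordinate -` box l u = box ?l ?u"
    by (auto simp: mem_box_cart recoordinate_def)
       (metis the_original_inverse Copy_inverse UNIV_I)+
  then have "emeasure (distr lborel borel (recoordinate :: real ^ 'n \<Rightarrow> _)) (box l u)
      = emeasure lborel (box ?l ?u)"
    by (subst emeasure_distr) auto
  also have "\<dots> = ennreal (\<Prod>b\<in>Basis. (?u - ?l) \<bullet> b)"
    by (rule emeasure_lborel_box) (auto simp: Basis_vec_def inner_axis le')
  also have "(\<Prod>b\<in>Basis. (?u - ?l) \<bullet> b) = (\<Prod>i\<in>UNIV. u $ Copy i - l $ Copy i)"
    by (simp add: prod_Basis_cart inner_axis)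
  also have "\<dots> = (\<Prod>i\<in>UNIV. u $ i - l $ i)"
    by (rule prod.reindex_bij_betw)
       (auto intro!: bij_betw_byWitness[where f' = the_original] simp: the_original_inverse Copy_inverse)
  also have "\<dots> = (\<Prod>b\<in>Basis. (u - l) \<bullet> b)"
    by (simp add: prod_Basis_cart inner_axis)
  finally show "emeasure (distr lborel borel (recoordinate :: real ^ 'n \<Rightarrow> _)) (box l u)
      = ennreal (\<Prod>b\<in>Basis. (u - l) \<bullet> b)" .
qed simp

lemma measure_recoordinate:
  fixes K :: "(real ^ 'n::finite) set"
  assumes "compact K"
  shows "measure lborel (recoordinate ` K) = measure lborel K"
proof -
  have [measurable]: "(recoordinate :: real ^ 'n \<Rightarrow> _) \<in> borel_measurable borel"
    by (rule borel_measurable_continuous_onI[OF continuous_on_recoordinate])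
  have c: "compact (recoordinate ` K)"
    by (rule compact_continuous_image[OF continuous_on_recoordinate assms])
  have "measure lborel (recoordinate ` K)
      = measure (distr lborel borel (recoordinate :: real ^ 'n \<Rightarrow> _)) (recoordinate ` K)"
    by (simp add: distr_recoordinate)
  also have "\<dots> = measure lborel (recoordinate -` recoordinate ` K)"
    by (subst measure_distr) (use borel_compact[OF c] in auto)
  also have "recoordinate -` recoordinate ` K = K"
    by (rule inj_vimage_image_eq[OF bij_is_inj[OF bij_recoordinate]])
  finally show ?thesis .
qed

text \<open>
  Here parallel bodies and volumes are transported along the relabelling of coordinates.
\<close>

theorem steiner_formula:
  fixes K :: "(real ^ 'n::finite) set"
  assumes K: "compact K" "convex K" "K \<noteq> {}"
  shows "\<exists>q. degree q \<le> CARD('n) \<and> (\<forall>t\<ge>0. poly q t = measure lborel (parallel_body K t))"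
proof -
  let ?K = "recoordinate ` K"
  have K': "compact ?K" "convex ?K" "?K \<noteq> {}"
    using K by (auto intro: compact_continuous_image[OF continuous_on_recoordinate]
      convex_linear_image[OF linear_recoordinate])
  have "measure lebesgue (parallel_body ?K t) = measure lborel (parallel_body K t)" for t
    using measure_recoordinate[OF compact_parallel_body[OF K(1)], of t]
      measure_lborel_compact[OF compact_parallel_body[OF K'(1)], of t]
    by (simp add: parallel_body_recoordinate)
  moreover have "CARD('n ordered_copy) = CARD('n)"
    by (rule bij_betw_same_card[OF bij_the_original])
  ultimately show ?thesis using steiner_polynomial_wellorder[OF K'] by simp
qed

section \<open>Intrinsic volumes\<close>

lemma unit_ball_vol_neq_0: "unit_ball_vol (real n) \<noteq> 0"
  by (rule less_imp_neq[symmetric]) simp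

text \<open>
  A polynomial is determined by its values on the half line, and the ball volumes do not vanish;
  this is what makes the definite description in \<^const>\<open>intrinsic_volume\<close> well defined.
\<close>

lemma steiner_coefficients_unique:
  fixes v w :: "nat \<Rightarrow> real"
  assumes "\<And>t. t \<ge> 0 \<Longrightarrow> (\<Sum>j\<le>d. unit_ball_vol (real (d - j)) * t ^ (d - j) * v j)
      = (\<Sum>j\<le>d. unit_ball_vol (real (d - j)) * t ^ (d - j) * w j)"
    and "j \<le> d"
  shows "v j = w j"
proof -
  define p where "p x = (\<Sum>j\<le>d. monom (unit_ball_vol (real (d - j)) * x j) (d - j))" for x :: "nat \<Rightarrow> real"
  have eq: "poly (p v) t = poly (p w) t" if "t \<ge> 0" for t
    using assms(1)[OF that] by (simp add: p_def poly_sum poly_monom mult_ac)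
  have "p v = p w"
  proof (rule ccontr)
    assume "p v \<noteq> p w"
    then have "finite {t. poly (p v - p w) t = 0}" by (intro poly_roots_finite) simp
    moreover have "{0..} \<subseteq> {t. poly (p v - p w) t = 0}" using eq by auto
    ultimately show False using infinite_Ici[of "0::real"] finite_subset by blast
  qed
  moreover have "coeff (p x) (d - j) = unit_ball_vol (real (d - j)) * x j" for x
  proof -
    have "coeff (p x) (d - j) = (\<Sum>i\<le>d. if i = j then unit_ball_vol (real (d - j)) * x j else 0)"
      unfolding p_def coeff_sum by (intro sum.cong) (use assms(2) in auto)
    then show ?thesis using assms(2) by simp
  qed
  ultimately have "unit_ball_vol (real (d - j)) * v j = unit_ball_vol (real (d - j)) * w j" by metis
  then show ?thesis using unit_ball_vol_neq_0[of "d - j"] by (simp del: of_nat_diff)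
qed

theorem measure_parallel_body_intrinsic_volume:
  fixes K :: "(real ^ 'n::finite) set"
  assumes K: "compact K" "convex K" "K \<noteq> {}" and t: "t \<ge> 0"
  shows "measure lborel (parallel_body K t) =
    (\<Sum>j\<le>CARD('n). unit_ball_vol (real (CARD('n) - j)) * t ^ (CARD('n) - j) * intrinsic_volume j K)"
proof -
  let ?d = "CARD('n)"
  let ?P = "\<lambda>v. (\<forall>t\<ge>0. measure lborel (parallel_body K t) =
           (\<Sum>j\<le>?d. unit_ball_vol (real (?d - j)) * t ^ (?d - j) * v j)) \<and> (\<forall>j>?d. v j = 0)"
  obtain q where q: "degree q \<le> ?d" "\<And>t. t \<ge> 0 \<Longrightarrow> poly q t = measure lborel (parallel_body K t)"
    using steiner_formula[OF K] by blast
  define v where "v j = (if j \<le> ?d then coeff q (?d - j) / unit_ball_vol (real (?d - j)) else 0)" for j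
  have "?P v"
  proof (intro conjI allI impI)
    fix t :: real assume t: "t \<ge> 0"
    have "measure lborel (parallel_body K t) = (\<Sum>i\<le>degree q. coeff q i * t ^ i)"
      using q(2)[OF t] poly_altdef[of q t] by simp
    also have "\<dots> = (\<Sum>i\<le>?d. coeff q i * t ^ i)"
      by (rule sum.mono_neutral_left) (use q(1) in \<open>auto simp: coeff_eq_0\<close>)
    also have "\<dots> = (\<Sum>j\<le>?d. coeff q (?d - j) * t ^ (?d - j))"
      by (rule sum.reindex_bij_witness[of _ "\<lambda>j. ?d - j" "\<lambda>j. ?d - j"]) auto
    also have "\<dots> = (\<Sum>j\<le>?d. unit_ball_vol (real (?d - j)) * t ^ (?d - j) * v j)"
    proof (intro sum.cong refl)
      fix j assume "j \<in> {..?d}"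
      then show "coeff q (?d - j) * t ^ (?d - j) = unit_ball_vol (real (?d - j)) * t ^ (?d - j) * v j"
        using unit_ball_vol_neq_0[of "?d - j"] unfolding v_def by (simp del: of_nat_diff)
    qed
    finally show "measure lborel (parallel_body K t) = \<dots>" .
  qed (simp add: v_def)
  note v = this
  have "w = v" if w: "?P w" for w
  proof
    fix j
    show "w j = v j"
    proof (cases "j \<le> ?d")
      case True
      show ?thesis
      proof (rule steiner_coefficients_unique[OF _ True])
        fix t :: real assume t: "t \<ge> 0"
        show "(\<Sum>j\<le>?d. unit_ball_vol (real (?d - j)) * t ^ (?d - j) * w j)
            = (\<Sum>j\<le>?d. unit_ball_vol (real (?d - j)) * t ^ (?d - j) * v j)"
          by (rule trans[OF sym[OF w[THEN conjunct1, rule_format, OF t]]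
                v[THEN conjunct1, rule_format, OF t]])
      qed
    next
      case False
      then show ?thesis using w v by simp
    qed
  qed
  with v have "?P (THE v. ?P v)" by (rule theI)
  then show ?thesis
    using t unfolding intrinsic_volume_def DIM_cart DIM_real mult_1_right by blast
qed

text \<open>
  If \<open>K\<close> is contained in a ball of radius \<open>r\<close>, then \<open>K + t B\<close> is contained in a ball of radius
  \<open>r + t\<close>. Dividing the volumes by \<open>t\<^sup>d\<close> and letting \<open>t\<close> tend to infinity compares the leading
  coefficients. The integrability assumption of the theorem covers only the indices \<open>1, \<dots>, d\<close>, and
  this bound supplies the index \<open>0\<close>.
\<close>

lemma intrinsic_volume_0_le_1:
  fixes K :: "(real ^ 'n::finite) set"
  assumes K: "compact K" "convex K" "K \<noteq> {}"
  shows "intrinsic_volume 0 K \<le> 1"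
proof -
  let ?d = "CARD('n)"
  let ?k = "unit_ball_vol (real ?d)"
  let ?c = "\<lambda>j. unit_ball_vol (real (?d - j)) * intrinsic_volume j K"
  obtain r where r: "r > 0" "K \<subseteq> cball 0 r"
    using compact_imp_bounded[OF K(1)] unfolding bounded_pos by (auto simp: subset_iff)
  have le: "(\<Sum>j\<le>?d. ?c j * (1 / t) ^ j) \<le> ?k * (1 + r * (1 / t)) ^ ?d" if t: "t > 0" for t
  proof -
    have "parallel_body K t \<subseteq> parallel_body (cball 0 r) t"
      by (rule parallel_body_mono[OF r(2)]) simp
    also have "\<dots> \<subseteq> cball 0 (r + t)"
      by (auto simp: parallel_body_eq_sums intro: norm_triangle_mono)
    finally have "measure lborel (parallel_body K t) \<le> measure lborel (cball 0 (r + t) :: (real ^ 'n) set)"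
      by (rule measure_mono_fmeasurable)
         (auto intro!: fmeasurableI borel_compact compact_parallel_body K(1)
           simp: emeasure_lborel_cball_finite[simplified])
    also have "\<dots> = ?k * (r + t) ^ ?d" using content_cball[of "r + t" "0 :: real ^ 'n"] r(1) t by simp
    also have "r + t = t * (1 + r * (1 / t))" using t by (simp add: field_simps)
    finally have "measure lborel (parallel_body K t) \<le> t ^ ?d * (?k * (1 + r * (1 / t)) ^ ?d)"
      by (simp only: power_mult_distrib mult_ac)
    moreover have "measure lborel (parallel_body K t) = t ^ ?d * (\<Sum>j\<le>?d. ?c j * (1 / t) ^ j)"
      unfolding measure_parallel_body_intrinsic_volume[OF K less_imp_le[OF t]] sum_distrib_left
      by (intro sum.cong refl) (use t in \<open>simp add: power_diff power_one_over field_simps\<close>)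
    ultimately show ?thesis using t by simp
  qed
  have t0: "((\<lambda>t::real. 1 / t) \<longlongrightarrow> 0) at_top"
    by (intro tendsto_divide_0[OF tendsto_const] filterlim_at_top_imp_at_infinity filterlim_ident)
  have "((\<lambda>t. \<Sum>j\<le>?d. ?c j * (1 / t) ^ j) \<longlongrightarrow> (\<Sum>j\<le>?d. ?c j * 0 ^ j)) at_top"
    by (intro tendsto_intros t0)
  moreover have "(\<Sum>j\<le>?d. ?c j * 0 ^ j) = ?k * intrinsic_volume 0 K"
    by (subst sum.atMost_shift) simp
  moreover have "((\<lambda>t. ?k * (1 + r * (1 / t)) ^ ?d) \<longlongrightarrow> ?k * (1 + r * 0) ^ ?d) at_top"
    by (intro tendsto_intros t0)
  ultimately have "?k * intrinsic_volume 0 K \<le> ?k * (1 + r * 0) ^ ?d"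
    by (intro tendsto_le[of at_top, OF _ _ _ eventually_mono[OF eventually_gt_at_top[of 0] le]]) simp_all
  then show ?thesis by simp
qed

section \<open>A Poisson process has finitely many points in a set of finite intensity\<close>

lemma point_count_mono: "A \<subseteq> B \<Longrightarrow> point_count c A \<le> point_count c B"
  unfolding point_count_def
  by (rule infsum_mono_neutral) (auto intro!: nonneg_summable_on_complete)

text \<open>
  The Poisson weights of the finite values sum to one, which leaves no mass for the value \<open>\<infinity>\<close>.
\<close>

lemma poisson_process_AE_finite:
  assumes "poisson_process P \<Lambda> \<eta>" "B \<in> sets \<Lambda>" "emeasure \<Lambda> B < \<infinity>"
  shows "AE \<omega> in P. point_count (\<eta> \<omega>) B < \<infinity>"
proof -
  let ?l = "measure \<Lambda> B"
  define N where "N k = {\<omega>\<in>space P. point_count (\<eta> \<omega>) B = of_nat k}" for k :: nat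
  interpret prob_space P using assms(1) by (simp add: poisson_process_def)
  have meas[measurable]: "(\<lambda>\<omega>. point_count (\<eta> \<omega>) B) \<in> borel_measurable P"
    using assms(1,2) by (auto simp: poisson_process_def point_process_def)
  have N: "N k \<in> events" for k unfolding N_def by measurable
  have "(\<lambda>k. prob (N k)) sums prob (\<Union>k. N k)"
    by (rule finite_measure_UNION) (use N in \<open>auto simp: disjoint_family_on_def N_def\<close>)
  moreover have "prob (N k) = ?l ^ k / fact k * exp (- ?l)" for k
    using assms by (simp add: poisson_process_def N_def)
  moreover have "(\<lambda>k. ?l ^ k / fact k * exp (- ?l)) sums (exp ?l * exp (- ?l))"
    using exp_converges[of ?l] by (intro sums_mult2) (simp add: scaleR_conv_of_real field_simps)
  ultimately have "prob (\<Union>k. N k) = exp ?l * exp (- ?l)"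
    using sums_unique2 by simp
  then have "prob (\<Union>k. N k) = 1" by (simp flip: exp_add)
  then have "AE \<omega> in P. \<omega> \<in> (\<Union>k. N k)" by (rule AE_prob_1)
  then show ?thesis
  proof (rule AE_mp, intro AE_I2 impI)
    fix \<omega> assume "\<omega> \<in> (\<Union>k. N k)"
    then obtain k where "point_count (\<eta> \<omega>) B = of_nat k" by (auto simp: N_def)
    then show "point_count (\<eta> \<omega>) B < \<infinity>" by (simp add: of_nat_less_top)
  qed
qed

section \<open>The intensity of the grains that hit a bounded set\<close>

lemma closed_support_eq_mark_support:
  assumes "\<And>y. g m y \<ge> 0"
  shows "closed_support (g m) = mark_support g m"
proof -
  have "{x. g m x \<noteq> 0} = {x. g m x > 0}" using assms by (auto simp: less_le)
  then show ?thesis by (simp add: closed_support_def mark_support_def)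
qed

text \<open>
  Moving \<open>f\<close> by less than its integral over \<open>A\<close> in the \<open>L\<^sup>1\<close> distance keeps this integral positive.
\<close>

lemma L1_open_integral_positive:
  assumes A: "A \<in> sets lborel"
  shows "L1_open {f \<in> L1_tilde. (LINT x:A|lborel. f x) > 0}"
  unfolding L1_open_def
proof (intro conjI ballI)
  fix f :: "'a \<Rightarrow> real" assume f: "f \<in> {f \<in> L1_tilde. (LINT x:A|lborel. f x) > 0}"
  let ?e = "LINT x:A|lborel. f x"
  show "\<exists>e>0. \<forall>h\<in>L1_tilde. L1_dist f h < e \<longrightarrow> h \<in> {f \<in> L1_tilde. (LINT x:A|lborel. f x) > 0}"
  proof (intro exI[of _ ?e] conjI ballI impI)
    fix h assume h: "h \<in> L1_tilde" and d: "L1_dist f h < ?e"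
    have int: "integrable lborel f" "integrable lborel h" using f h by (auto simp: L1_tilde_def)
    then have intA: "set_integrable lborel A f" "set_integrable lborel A h"
      using A unfolding set_integrable_def by (intro integrable_mult_indicator; simp)+
    have "?e - (LINT x:A|lborel. h x) = (LINT x:A|lborel. f x - h x)"
      using intA by simp
    also have "\<dots> \<le> L1_dist f h"
      unfolding L1_dist_def set_lebesgue_integral_def
    proof (rule integral_mono)
      show "integrable lborel (\<lambda>x. indicat_real A x *\<^sub>R (f x - h x))"
        using int A by (intro integrable_mult_indicator) auto
      show "integrable lborel (\<lambda>x. \<bar>f x - h x\<bar>)" using int by auto
      show "indicat_real A x *\<^sub>R (f x - h x) \<le> \<bar>f x - h x\<bar>" for x
        by (auto simp: indicator_def)
    qed
    finally show "h \<in> {f \<in> L1_tilde. (LINT x:A|lborel. f x) > 0}" using d h by simp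
  qed (use f in auto)
qed auto

lemma space_L1_borel: "space L1_borel = L1_tilde"
  unfolding L1_borel_def by (rule space_measure_of) (auto simp: L1_open_def)

lemma sets_integral_positive:
  fixes g :: "'m \<Rightarrow> 'a::euclidean_space \<Rightarrow> real"
  assumes "g \<in> Q \<rightarrow>\<^sub>M L1_borel" "A \<in> sets lborel"
  shows "{m\<in>space Q. (LINT x:A|lborel. g m x) > 0} \<in> sets Q"
proof -
  let ?U = "{f \<in> L1_tilde. (LINT x:A|lborel. f x) > 0}"
  have "?U \<in> sets L1_borel"
    unfolding L1_borel_def using L1_open_integral_positive[OF assms(2)]
    by (subst sets_measure_of) (auto simp: L1_open_def)
  then have "g -` ?U \<inter> space Q \<in> sets Q" by (rule measurable_sets[OF assms(1)])
  moreover have "g -` ?U \<inter> space Q = {m\<in>space Q. (LINT x:A|lborel. g m x) > 0}"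
    using measurable_space[OF assms(1)] by (auto simp: space_L1_borel)
  ultimately show ?thesis by simp
qed

text \<open>
  This turns the geometric event that a grain meets a ball into a condition on an integral, which is
  measurable in the mark. If the closed support \<open>K\<close> meets the open ball, then \<open>f\<close> is positive at
  some point \<open>z\<close> of \<open>K\<close> in the ball, hence by continuity on \<open>K\<close> near \<open>z\<close>. A convex set of
  positive volume is the closure of its interior, so every neighbourhood of \<open>z\<close> contains a
  nonempty open part of \<open>K\<close>, and this part contributes to the integral.
\<close>

lemma integral_ball_positive_iff:
  fixes f :: "'a::euclidean_space \<Rightarrow> real"
  assumes f: "f \<in> L1_tilde" "\<And>y. f y \<ge> 0" "measure lborel (closed_support f) > 0"
  shows "(LINT x:ball q r|lborel. f x) > 0 \<longleftrightarrow> closed_support f \<inter> ball q r \<noteq> {}"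
proof -
  let ?K = "closed_support f"
  let ?h = "\<lambda>x. indicat_real (ball q r) x *\<^sub>R f x"
  have int: "integrable lborel ?h"
    using f(1) by (intro integrable_mult_indicator) (auto simp: L1_tilde_def)
  have nn: "?h x \<ge> 0" for x using f(2)[of x] by (simp add: indicator_def)
  show ?thesis
  proof
    assume pos: "(LINT x:ball q r|lborel. f x) > 0"
    show "?K \<inter> ball q r \<noteq> {}"
    proof
      assume e: "?K \<inter> ball q r = {}"
      have "?h x = 0" for x
      proof (cases "f x = 0")
        case False
        then have "x \<in> ?K" using closure_subset[of "{x. f x \<noteq> 0}"] by (auto simp: closed_support_def)
        then show ?thesis using e by (auto simp: indicator_def)
      qed simp
      then have "?h = (\<lambda>x. 0)" by (rule ext)
      with pos show False unfolding set_lebesgue_integral_def by (simp only: integral_zero less_irrefl)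
    qed
  next
    assume "?K \<inter> ball q r \<noteq> {}"
    then have "{x. f x \<noteq> 0} \<inter> ball q r \<noteq> {}"
      using open_Int_closure_eq_empty[of "ball q r" "{x. f x \<noteq> 0}"]
      by (auto simp: closed_support_def Int_commute)
    then obtain z where z: "f z \<noteq> 0" "z \<in> ball q r" by auto
    then have zK: "z \<in> ?K" and fz: "f z > 0"
      using closure_subset[of "{x. f x \<noteq> 0}"] f(2)[of z] by (auto simp: closed_support_def)
    have K: "compact ?K" "convex ?K" "continuous_on ?K f" using f(1) by (auto simp: L1_tilde_def)
    obtain e1 where e1: "e1 > 0" "\<And>x. x \<in> ?K \<Longrightarrow> dist x z < e1 \<Longrightarrow> dist (f x) (f z) < f z"
      using K(3) zK fz unfolding continuous_on_iff by metis
    obtain e2 where e2: "e2 > 0" "ball z e2 \<subseteq> ball q r"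
      using z(2) open_ball[of q r] unfolding open_contains_ball by blast
    define S where "S = interior ?K \<inter> ball z (min e1 e2)"
    have "\<not> negligible ?K"
      using f(3) measure_lborel_compact[OF K(1)] negligible_imp_measure0[of ?K] by auto
    then have "interior ?K \<noteq> {}" using negligible_convex_interior[OF K(2)] by simp
    then have "z \<in> closure (interior ?K)"
      using convex_closure_interior[OF K(2)] zK closure_subset by blast
    moreover have "min e1 e2 > 0" using e1(1) e2(1) by simp
    ultimately obtain y where "y \<in> interior ?K" "dist y z < min e1 e2"
      unfolding closure_approachable by blast
    then have "y \<in> S" by (simp add: S_def dist_commute)
    then have "S \<noteq> {}" by auto
    have "open S" unfolding S_def by (intro open_Int open_interior open_ball)
    have "?h x \<noteq> 0" if "x \<in> S" for x
    proof -
      have "x \<in> ?K" "dist x z < e1" "x \<in> ball z e2"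
        using that interior_subset[of ?K] by (auto simp: S_def dist_commute)
      moreover from this have "x \<in> ball q r" using e2(2) by blast
      ultimately have "x \<in> ?K" "dist x z < e1" "x \<in> ball q r" by blast+
      then have "f x > 0" using e1(2)[of x] by (auto simp: dist_real_def)
      then show ?thesis using \<open>x \<in> ball q r\<close> by (simp add: indicator_def)
    qed
    note S = this
    have "(LINT x|lborel. ?h x) \<noteq> 0"
    proof
      assume "(LINT x|lborel. ?h x) = 0"
      then have "AE x in lborel. ?h x = 0"
        using integral_nonneg_eq_0_iff_AE[OF int] nn by auto
      then have "AE x in lborel. x \<notin> S" by (rule AE_mp) (use S in auto)
      then have "S \<in> null_sets lborel"
        using AE_iff_null_sets[of S lborel] \<open>open S\<close> by simp
      then have "negligible S" by (simp add: negligible_iff_null_sets null_sets_completionI)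
      then show False using \<open>open S\<close> \<open>S \<noteq> {}\<close> open_not_negligible by blast
    qed
    moreover have "(LINT x|lborel. ?h x) \<ge> 0" using nn by (rule Bochner_Integration.integral_nonneg)
    ultimately show "(LINT x:ball q r|lborel. f x) > 0" by (simp add: set_lebesgue_integral_def)
  qed
qed

lemma vimage_uminus_measure:
  fixes B :: "'a::euclidean_space set"
  assumes "B \<in> sets borel"
  shows "emeasure lborel (uminus -` B) = emeasure lborel B"
proof -
  have "distr lborel borel uminus = (lborel :: 'a measure)"
    using lborel_affine[of "- 1" "0 :: 'a"] by (simp add: density_1)
  then have "emeasure lborel B = emeasure (distr lborel borel uminus) B" by simp
  also have "\<dots> = emeasure lborel (uminus -` B \<inter> space lborel)"
    by (rule emeasure_distr) (use assms in auto)
  finally show ?thesis by simp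
qed

text \<open>
  The hitting set is covered by countably many measurable rectangles: if the grain
  \<open>K\<^sub>m + x\<close> meets \<open>A\<close> at \<open>z + x\<close>, choose \<open>q\<close> from a countable dense set within distance \<open>1\<close> of \<open>z\<close>;
  then \<open>x\<close> is close to \<open>- q\<close> and \<open>K\<^sub>m\<close> meets the unit ball around \<open>q\<close>. This avoids deciding whether
  the hitting set itself is measurable. The section of the cover at \<open>m\<close> lies in a reflected
  parallel body of \<open>K\<^sub>m\<close> with fixed radius, whose volume is integrable in \<open>m\<close> by the Steiner formula
  and the integrability of the intrinsic volumes.
\<close>

lemma hitting_set_cover:
  fixes g :: "'m \<Rightarrow> real ^ 'd \<Rightarrow> real"
  assumes Q: "prob_space Q" and g: "g \<in> Q \<rightarrow>\<^sub>M L1_borel"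
    and nn: "\<And>m y. m \<in> space Q \<Longrightarrow> g m y \<ge> 0"
    and ne: "\<And>m. m \<in> space Q \<Longrightarrow> mark_support g m \<noteq> {}"
    and pos: "\<And>m. m \<in> space Q \<Longrightarrow> measure lborel (mark_support g m) > 0"
    and iv: "\<And>i. i \<in> {1..CARD('d)} \<Longrightarrow> integrable Q (\<lambda>m. intrinsic_volume i (mark_support g m))"
    and A: "bounded A"
  shows "\<exists>C\<in>sets (lborel \<Otimes>\<^sub>M Q). hitting_set Q g A \<subseteq> C \<and> emeasure (lborel \<Otimes>\<^sub>M Q) C < \<infinity>"
proof -
  interpret Q: prob_space Q by fact
  interpret pair_sigma_finite lborel Q ..
  let ?d = "CARD('d)"
  obtain R where R: "R > 0" "\<And>a. a \<in> A \<Longrightarrow> norm a \<le> R" using A bounded_pos by metis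
  obtain D :: "(real ^ 'd) set" where D: "countable D" "\<And>X. open X \<Longrightarrow> X \<noteq> {} \<Longrightarrow> \<exists>q\<in>D. q \<in> X"
    using countable_dense_setE by blast
  define H where "H q = {m\<in>space Q. (LINT x:ball q 1|lborel. g m x) > 0}" for q
  have L1: "g m \<in> L1_tilde" if "m \<in> space Q" for m
    using measurable_space[OF g that] by (simp add: space_L1_borel)
  have K: "compact (mark_support g m)" "convex (mark_support g m)" if "m \<in> space Q" for m
    using L1[OF that] closed_support_eq_mark_support[of g m, OF nn[OF that]] by (auto simp: L1_tilde_def)
  have H: "H q = {m\<in>space Q. mark_support g m \<inter> ball q 1 \<noteq> {}}" for q
    unfolding H_def
  proof (intro Collect_cong conj_cong refl)
    fix m assume m: "m \<in> space Q"
    show "(LINT x:ball q 1|lborel. g m x) > 0 \<longleftrightarrow> mark_support g m \<inter> ball q 1 \<noteq> {}"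
      using integral_ball_positive_iff[OF L1[OF m] nn[OF m]] pos[OF m]
      unfolding closed_support_eq_mark_support[of g m, OF nn[OF m]] by blast
  qed
  have Hs: "H q \<in> sets Q" for q unfolding H_def by (rule sets_integral_positive[OF g]) simp
  define C where "C = (\<Union>q\<in>D. ball (- q) (R + 1) \<times> H q)"
  have C: "C \<in> sets (lborel \<Otimes>\<^sub>M Q)"
    unfolding C_def by (rule sets.countable_UN''[OF D(1)]) (rule pair_measureI[OF _ Hs], simp)
  have sub: "hitting_set Q g A \<subseteq> C"
  proof
    fix p assume "p \<in> hitting_set Q g A"
    then obtain x m z where p: "p = (x, m)" "m \<in> space Q" "z \<in> mark_support g m" "z + x \<in> A"
      by (auto simp: hitting_set_def)
    obtain q where q: "q \<in> D" "q \<in> ball z 1" using D(2)[of "ball z 1"] by auto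
    have "dist (- q) x = norm ((z + x) + (q - z))" by (simp add: dist_norm norm_minus_commute add.commute)
    also have "\<dots> < R + 1"
      using norm_triangle_ineq[of "z + x" "q - z"] R(2)[OF p(4)] q(2)
      by (simp add: dist_norm norm_minus_commute)
    finally have "x \<in> ball (- q) (R + 1)" by simp
    moreover have "m \<in> H q" unfolding H using p(2,3) q(2) by (auto simp: dist_commute)
    ultimately show "p \<in> C" unfolding C_def p(1) using q(1) by blast
  qed
  let ?w = "\<lambda>j. unit_ball_vol (real (?d - j)) * (R + 2) ^ (?d - j)"
  let ?f = "\<lambda>m. ?w 0 + (\<Sum>j\<in>{1..?d}. ?w j * intrinsic_volume j (mark_support g m))"
  have section_le: "emeasure lborel ((\<lambda>x. (x, m)) -` C) \<le> ennreal (?f m)" if m: "m \<in> space Q" for m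
  proof -
    let ?B = "parallel_body (mark_support g m) (R + 2)"
    have cB: "compact ?B" by (rule compact_parallel_body[OF K(1)[OF m]])
    have "(\<lambda>x. (x, m)) -` C \<subseteq> uminus -` ?B"
    proof
      fix x assume "x \<in> (\<lambda>x. (x, m)) -` C"
      then obtain q z where q: "dist (- q) x < R + 1" "z \<in> mark_support g m" "dist q z < 1"
        by (auto simp: C_def H)
      have "dist z (- x) \<le> dist z q + dist q (- x)" by (rule dist_triangle)
      also have "dist q (- x) = dist (- q) x" by (metis dist_minus minus_minus)
      finally have "dist z (- x) \<le> R + 2" using q(1,3) by (simp add: dist_commute[of q z])
      then show "x \<in> uminus -` ?B" using q(2) by (auto simp: parallel_body_def)
    qed
    then have "emeasure lborel ((\<lambda>x. (x, m)) -` C) \<le> emeasure lborel (uminus -` ?B)"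
      by (rule emeasure_mono) (use measurable_sets_borel[OF borel_measurable_uminus[OF measurable_ident] borel_compact[OF cB]]
          in simp)
    also have "\<dots> = emeasure lborel ?B" by (rule vimage_uminus_measure[OF borel_compact[OF cB]])
    also have "\<dots> = ennreal (measure lborel ?B)"
      using emeasure_compact_finite[OF cB] by (intro emeasure_eq_ennreal_measure) (auto simp: less_top)
    also have "measure lborel ?B = (\<Sum>j\<le>?d. ?w j * intrinsic_volume j (mark_support g m))"
      using R(1) by (intro measure_parallel_body_intrinsic_volume K[OF m] ne[OF m]) simp
    also have "\<dots> = ?w 0 * intrinsic_volume 0 (mark_support g m)
        + (\<Sum>j\<in>{1..?d}. ?w j * intrinsic_volume j (mark_support g m))"
      by (simp add: sum.atMost_shift sum.atLeast1_atMost_eq atMost_atLeast0 sum.atLeast_Suc_atMost)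
    also have "\<dots> \<le> ?f m"
      using mult_left_mono[OF intrinsic_volume_0_le_1[OF K[OF m] ne[OF m]], of "?w 0"] R(1) by simp
    finally show ?thesis by (simp add: ennreal_leI)
  qed
  \<comment> \<open>The volumes of the sections are integrated over the marks by Tonelli's theorem.\<close>
  have "emeasure (lborel \<Otimes>\<^sub>M Q) C = (\<integral>\<^sup>+m. emeasure lborel ((\<lambda>x. (x, m)) -` C) \<partial>Q)"
    by (rule emeasure_pair_measure_alt2[OF C])
  also have "\<dots> \<le> (\<integral>\<^sup>+m. ennreal (?f m) \<partial>Q)"
    by (rule nn_integral_mono) (rule section_le)
  also have "\<dots> \<le> (\<integral>\<^sup>+m. ennreal (norm (?f m)) \<partial>Q)"
    by (intro nn_integral_mono ennreal_leI) simp
  also have "\<dots> < \<infinity>"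
  proof -
    have "integrable Q ?f" using iv by (intro Bochner_Integration.integrable_add integrable_sum integrable_mult_right) auto
    then show ?thesis unfolding integrable_iff_bounded by blast
  qed
  finally show ?thesis using C sub by blast
qed

section \<open>The excursion set as a finite union\<close>

text \<open>
  On the intersection of the window with the grains all summands are continuous and concave;
  the piece is a superlevel set of their sum on this compact convex domain.
\<close>

lemma compact_convex_excursion_piece:
  fixes A :: "'a::euclidean_space set"
  assumes A: "compact A" "convex A"
    and K: "\<And>j. j \<in> I \<Longrightarrow> compact (mark_support g (m j))"
    and cont: "\<And>j. j \<in> I \<Longrightarrow> continuous_on (mark_support g (m j)) (g (m j))"
    and conc: "\<And>j. j \<in> I \<Longrightarrow> concave_on (mark_support g (m j)) (g (m j))"
  shows "compact (excursion_piece g A u x m I)" "convex (excursion_piece g A u x m I)"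
proof -
  let ?C = "A \<inter> (\<Inter>j\<in>I. (\<lambda>z. z + x j) ` mark_support g (m j))"
  let ?s = "\<lambda>y. \<Sum>j\<in>I. g (m j) (y - x j)"
  have eq: "excursion_piece g A u x m I = ?C \<inter> ?s -` {u..}"
    by (auto simp: excursion_piece_def)
  have mem: "y \<in> (\<lambda>z. z + x j) ` mark_support g (m j) \<longleftrightarrow> y - x j \<in> mark_support g (m j)" for y j
    by (auto intro!: image_eqI[of _ _ "y - x j"])
  have "compact ((\<lambda>z. z + x j) ` mark_support g (m j))" if "j \<in> I" for j
    by (intro compact_continuous_image K that continuous_intros)
  then have C: "compact ?C"
    by (intro compact_Int_closed[OF A(1)] closed_INT) (auto intro: compact_imp_closed)
  have "continuous_on ?C ?s"
  proof (intro continuous_on_sum)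
    fix j assume j: "j \<in> I"
    show "continuous_on ?C (\<lambda>y. g (m j) (y - x j))"
      by (rule continuous_on_compose2[OF cont[OF j]]) (use j mem in \<open>auto intro!: continuous_intros\<close>)
  qed
  then have "closed (?C \<inter> ?s -` {u..})"
    by (rule continuous_closed_preimage) (use C compact_imp_closed in auto)
  then have "compact (?C \<inter> (?C \<inter> ?s -` {u..}))" by (rule compact_Int_closed[OF C])
  then show "compact (excursion_piece g A u x m I)"
    unfolding eq by (simp add: Int_assoc[symmetric])
  show "convex (excursion_piece g A u x m I)"
  proof (rule convexI)
    fix y z and a b :: real
    assume y: "y \<in> excursion_piece g A u x m I" and z: "z \<in> excursion_piece g A u x m I"
      and ab: "0 \<le> a" "0 \<le> b" "a + b = 1"
    let ?w = "a *\<^sub>R y + b *\<^sub>R z"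
    have w: "?w - x j = a *\<^sub>R (y - x j) + b *\<^sub>R (z - x j)" for j
      using ab(3) by (simp add: algebra_simps scaleR_left_distrib[symmetric])
    have K': "y - x j \<in> mark_support g (m j)" "z - x j \<in> mark_support g (m j)" if "j \<in> I" for j
      using y z that by (auto simp: excursion_piece_def mem)
    have g: "?w - x j \<in> mark_support g (m j)"
      "a * g (m j) (y - x j) + b * g (m j) (z - x j) \<le> g (m j) (?w - x j)" if "j \<in> I" for j
      using conc[OF that] K'[OF that] ab unfolding w concave_on_iff convex_def by blast+
    have "u = a * u + b * u" using ab(3) by (simp flip: distrib_right)
    also have "\<dots> \<le> a * ?s y + b * ?s z"
      using y z ab by (intro add_mono mult_left_mono) (auto simp: excursion_piece_def)
    also have "\<dots> = (\<Sum>j\<in>I. a * g (m j) (y - x j) + b * g (m j) (z - x j))"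
      by (simp add: sum.distrib sum_distrib_left)
    also have "\<dots> \<le> ?s ?w" by (rule sum_mono) (rule g(2))
    finally have "u \<le> ?s ?w" .
    moreover have "?w \<in> A" using y z ab by (intro convexD[OF A(2)]) (auto simp: excursion_piece_def)
    ultimately show "?w \<in> excursion_piece g A u x m I"
      using g(1) by (auto simp: excursion_piece_def mem)
  qed
qed

text \<open>
  A point whose grain misses \<open>A\<close> contributes nothing at \<open>y \<in> A\<close>. The points whose grains hit \<open>A\<close> are
  listed with multiplicity, so that grouping the list by location recovers the weights \<open>c z\<close>.
\<close>

lemma shot_noise_eq_finite_sum:
  assumes c: "{z. c z \<noteq> 0} \<subseteq> UNIV \<times> space Q"
    and nn: "\<And>m y. m \<in> space Q \<Longrightarrow> g m y \<ge> 0"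
    and l: "lists_points c (hitting_set Q g A) n x m" and y: "y \<in> A"
  shows "shot_noise g c y = ennreal (\<Sum>j\<in>{1..n}. g (m j) (y - x j))"
proof -
  let ?S = "hitting_set Q g A" and ?p = "\<lambda>j. (x j, m j)"
  let ?G = "\<lambda>z. ennreal (g (snd z) (y - fst z))"
  have S: "?p j \<in> ?S" if "j \<in> {1..n}" for j using l that by (simp add: lists_points_def)
  have cnt: "card {j\<in>{1..n}. ?p j = z} = c z" if "z \<in> ?S" for z
    using l that by (simp add: lists_points_def)
  have "of_nat (c z) * ?G z = 0" if z: "z \<notin> ?p ` {1..n}" for z
  proof (cases "c z = 0")
    case False
    have "z \<notin> ?S"
    proof
      assume "z \<in> ?S"
      moreover have "{j\<in>{1..n}. ?p j = z} = {}" using z by auto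
      ultimately show False using cnt[of z] False by (metis card.empty)
    qed
    moreover have "snd z \<in> space Q" using c False by (cases z) auto
    ultimately have "y \<notin> (\<lambda>a. a + fst z) ` mark_support g (snd z)"
      using y by (cases z) (auto simp: hitting_set_def)
    then have "y - fst z \<notin> mark_support g (snd z)"
      by (metis diff_add_cancel image_eqI)
    then have "\<not> g (snd z) (y - fst z) > 0"
      using closure_subset[of "{a. g (snd z) a > 0}"] by (auto simp: mark_support_def)
    then have "?G z = 0" by (simp add: ennreal_neg)
    then show ?thesis by simp
  qed simp
  then have "shot_noise g c y = (\<Sum>\<^sub>\<infinity>z\<in>?p ` {1..n}. of_nat (c z) * ?G z)"
    unfolding shot_noise_def by (intro infsum_cong_neutral) auto
  also have "\<dots> = (\<Sum>z\<in>?p ` {1..n}. of_nat (c z) * ?G z)" by simp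
  also have "\<dots> = (\<Sum>z\<in>?p ` {1..n}. \<Sum>j\<in>{j\<in>{1..n}. ?p j = z}. ?G (?p j))"
  proof (intro sum.cong refl)
    fix z assume "z \<in> ?p ` {1..n}"
    then have "z \<in> ?S" using S by auto
    have "(\<Sum>j\<in>{j\<in>{1..n}. ?p j = z}. ?G (?p j)) = (\<Sum>j\<in>{j\<in>{1..n}. ?p j = z}. ?G z)"
      by (rule sum.cong) auto
    then show "of_nat (c z) * ?G z = (\<Sum>j\<in>{j\<in>{1..n}. ?p j = z}. ?G (?p j))"
      using cnt[OF \<open>z \<in> ?S\<close>] by simp
  qed
  also have "\<dots> = (\<Sum>j\<in>{1..n}. ?G (?p j))"
    by (rule sum.image_gen[symmetric]) simp
  also have "\<dots> = ennreal (\<Sum>j\<in>{1..n}. g (m j) (y - x j))"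
  proof -
    have "m j \<in> space Q" if "j \<in> {1..n}" for j using S[OF that] by (simp add: hitting_set_def)
    then have "g (m j) (y - x j) \<ge> 0" if "j \<in> {1..n}" for j using nn that by blast
    from sum_ennreal[of "{1..n}", OF this] show ?thesis by simp
  qed
  finally show ?thesis .
qed

text \<open>
  A point \<open>y\<close> of the excursion set belongs to the piece for the set \<open>I\<close> of all indices whose grains
  contain \<open>y\<close>; this \<open>I\<close> is nonempty because \<open>u > 0\<close>. Conversely, enlarging \<open>I\<close> to all indices
  only adds nonnegative summands.
\<close>

lemma excursion_set_eq_Union_pieces:
  assumes c: "{z. c z \<noteq> 0} \<subseteq> UNIV \<times> space Q"
    and nn: "\<And>m y. m \<in> space Q \<Longrightarrow> g m y \<ge> 0"
    and l: "lists_points c (hitting_set Q g A) n x m" and u: "u > 0"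
  shows "excursion_set g c u \<inter> A
    = (\<Union>I\<in>{I. I \<noteq> {} \<and> I \<subseteq> {1..n}}. excursion_piece g A u x m I)"
proof (intro set_eqI)
  fix y
  have sp: "m j \<in> space Q" if "j \<in> {1..n}" for j
    using l that by (auto simp: lists_points_def hitting_set_def)
  have mem: "y \<in> excursion_set g c u \<longleftrightarrow> u \<le> (\<Sum>j\<in>{1..n}. g (m j) (y - x j))" if "y \<in> A"
  proof -
    have "(\<Sum>j\<in>{1..n}. g (m j) (y - x j)) \<ge> 0" by (rule sum_nonneg) (rule nn[OF sp])
    moreover have "shot_noise g c y = ennreal (\<Sum>j\<in>{1..n}. g (m j) (y - x j))"
      by (rule shot_noise_eq_finite_sum[OF c nn l that])
    ultimately show ?thesis by (simp only: excursion_set_def mem_Collect_eq ennreal_le_iff)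
  qed
  show "y \<in> excursion_set g c u \<inter> A
    \<longleftrightarrow> y \<in> (\<Union>I\<in>{I. I \<noteq> {} \<and> I \<subseteq> {1..n}}. excursion_piece g A u x m I)"
  proof
    assume y: "y \<in> excursion_set g c u \<inter> A"
    define I where "I = {j\<in>{1..n}. y \<in> (\<lambda>z. z + x j) ` mark_support g (m j)}"
    have "g (m j) (y - x j) = 0" if "j \<in> {1..n} - I" for j
    proof -
      have "y - x j \<notin> mark_support g (m j)"
        using that by (auto simp: I_def) (metis diff_add_cancel image_eqI)
      then have "\<not> g (m j) (y - x j) > 0"
        using closure_subset[of "{a. g (m j) a > 0}"] by (auto simp: mark_support_def)
      then show ?thesis using nn[OF sp, of j "y - x j"] that by auto
    qed
    then have "(\<Sum>j\<in>{1..n}. g (m j) (y - x j)) = (\<Sum>j\<in>I. g (m j) (y - x j))"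
      by (intro sum.mono_neutral_right) (auto simp: I_def)
    then have le: "u \<le> (\<Sum>j\<in>I. g (m j) (y - x j))" using y mem by simp
    then have "I \<noteq> {}" using u by auto
    moreover have "I \<subseteq> {1..n}" by (auto simp: I_def)
    moreover have "y \<in> excursion_piece g A u x m I"
      using le y by (simp add: excursion_piece_def I_def)
    ultimately show "y \<in> (\<Union>I\<in>{I. I \<noteq> {} \<and> I \<subseteq> {1..n}}. excursion_piece g A u x m I)" by blast
  next
    assume "y \<in> (\<Union>I\<in>{I. I \<noteq> {} \<and> I \<subseteq> {1..n}}. excursion_piece g A u x m I)"
    then obtain I where I: "I \<subseteq> {1..n}" "y \<in> excursion_piece g A u x m I" by blast
    then have "u \<le> (\<Sum>j\<in>I. g (m j) (y - x j))" "y \<in> A" by (auto simp: excursion_piece_def)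
    moreover have "(\<Sum>j\<in>I. g (m j) (y - x j)) \<le> (\<Sum>j\<in>{1..n}. g (m j) (y - x j))"
      by (rule sum_mono2) (use I(1) nn sp in auto)
    ultimately show "y \<in> excursion_set g c u \<inter> A" using mem by auto
  qed
qed

theorem proposition1p1:
  fixes P :: "'w measure" and Q :: "'m measure"
    and \<gamma> u :: real
    and \<eta> :: "'w \<Rightarrow> (real ^ 'd) \<times> 'm \<Rightarrow> nat"
    and g :: "'m \<Rightarrow> real ^ 'd \<Rightarrow> real"
    and W :: "(real ^ 'd) set"
  assumes "prob_space Q"
    and "\<gamma> > 0"
    and "poisson_process P (scale_measure (ennreal \<gamma>) (lborel \<Otimes>\<^sub>M Q)) \<eta>"
    and "g \<in> Q \<rightarrow>\<^sub>M L1_borel"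
    and "\<And>m y. m \<in> space Q \<Longrightarrow> g m y \<ge> 0"
    and "\<And>m. m \<in> space Q \<Longrightarrow> mark_support g m \<noteq> {}"
    and "\<And>m. m \<in> space Q \<Longrightarrow> concave_on (mark_support g m) (g m)"
    and "\<And>m. m \<in> space Q \<Longrightarrow> measure lborel (mark_support g m) > 0"
    and "\<And>i. i \<in> {1..CARD('d)} \<Longrightarrow> integrable Q (\<lambda>m. intrinsic_volume i (mark_support g m))"
    and "compact W" and "convex W" and "measure lborel W > 0"
    and "u > 0"
  shows "\<forall>r::real. r \<ge> 1 \<longrightarrow>
    (AE \<omega> in P. point_count (\<eta> \<omega>) (hitting_set Q g (window W r)) < \<infinity>) \<and>
    (\<forall>\<omega>\<in>space P. \<forall>(n::nat) x m.
       point_count (\<eta> \<omega>) (hitting_set Q g (window W r)) = of_nat n \<and>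
       lists_points (\<eta> \<omega>) (hitting_set Q g (window W r)) n x m \<longrightarrow>
       (\<forall>I. I \<noteq> {} \<and> I \<subseteq> {1..n} \<longrightarrow>
          compact (excursion_piece g (window W r) u x m I) \<and>
          convex (excursion_piece g (window W r) u x m I)) \<and>
       excursion_set g (\<eta> \<omega>) u \<inter> window W r =
         (\<Union>I\<in>{I. I \<noteq> {} \<and> I \<subseteq> {1..n}}. excursion_piece g (window W r) u x m I))"
proof (intro allI impI)
  fix r :: real
  let ?A = "window W r"
  have A: "compact ?A" "convex ?A"
    using assms(10,11) by (auto simp: window_def intro: compact_scaling convex_scaling)
  have L1: "g m \<in> L1_tilde" if "m \<in> space Q" for m
    using measurable_space[OF assms(4) that] by (simp add: space_L1_borel)
  have K: "compact (mark_support g m)" "continuous_on (mark_support g m) (g m)" if "m \<in> space Q" for m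
    using L1[OF that] closed_support_eq_mark_support[of g m, OF assms(5)[OF that]]
    by (auto simp: L1_tilde_def)
  let ?L = "scale_measure (ennreal \<gamma>) (lborel \<Otimes>\<^sub>M Q)"
  obtain C where C: "C \<in> sets (lborel \<Otimes>\<^sub>M Q)" "hitting_set Q g ?A \<subseteq> C"
    "emeasure (lborel \<Otimes>\<^sub>M Q) C < \<infinity>"
    using hitting_set_cover[OF assms(1,4,5,6,8,9) compact_imp_bounded[OF A(1)]] by blast
  have "AE \<omega> in P. point_count (\<eta> \<omega>) C < \<infinity>"
    by (rule poisson_process_AE_finite[OF assms(3)])
       (use C in \<open>auto simp: ennreal_mult_less_top less_top\<close>)
  then have fin: "AE \<omega> in P. point_count (\<eta> \<omega>) (hitting_set Q g ?A) < \<infinity>"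
    by (rule AE_mp) (intro AE_I2 impI, erule le_less_trans[OF point_count_mono[OF C(2)]])
  have c: "{z. \<eta> \<omega> z \<noteq> 0} \<subseteq> UNIV \<times> space Q" if "\<omega> \<in> space P" for \<omega>
    using assms(3) that
    by (simp add: poisson_process_def point_process_def space_scale_measure space_pair_measure)
  have pieces: "compact (excursion_piece g ?A u x m I)" "convex (excursion_piece g ?A u x m I)"
    if "lists_points (\<eta> \<omega>) (hitting_set Q g ?A) n x m" "I \<subseteq> {1..n}" for \<omega> n x m I
  proof -
    have "m j \<in> space Q" if "j \<in> I" for j
      using that \<open>I \<subseteq> {1..n}\<close> \<open>lists_points (\<eta> \<omega>) (hitting_set Q g ?A) n x m\<close>
      by (auto simp: lists_points_def hitting_set_def)
    then show "compact (excursion_piece g ?A u x m I)" "convex (excursion_piece g ?A u x m I)"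
      using compact_convex_excursion_piece[OF A K assms(7)] by blast+
  qed
  show "(AE \<omega> in P. point_count (\<eta> \<omega>) (hitting_set Q g ?A) < \<infinity>) \<and>
    (\<forall>\<omega>\<in>space P. \<forall>(n::nat) x m.
       point_count (\<eta> \<omega>) (hitting_set Q g ?A) = of_nat n \<and>
       lists_points (\<eta> \<omega>) (hitting_set Q g ?A) n x m \<longrightarrow>
       (\<forall>I. I \<noteq> {} \<and> I \<subseteq> {1..n} \<longrightarrow>
          compact (excursion_piece g ?A u x m I) \<and> convex (excursion_piece g ?A u x m I)) \<and>
       excursion_set g (\<eta> \<omega>) u \<inter> ?A =
         (\<Union>I\<in>{I. I \<noteq> {} \<and> I \<subseteq> {1..n}}. excursion_piece g ?A u x m I))"
  proof (intro conjI fin ballI allI impI; (elim conjE)?)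
    fix \<omega> n x m
    assume \<omega>: "\<omega> \<in> space P" and l: "lists_points (\<eta> \<omega>) (hitting_set Q g ?A) n x m"
    show "excursion_set g (\<eta> \<omega>) u \<inter> ?A =
        (\<Union>I\<in>{I. I \<noteq> {} \<and> I \<subseteq> {1..n}}. excursion_piece g ?A u x m I)"
      by (rule excursion_set_eq_Union_pieces[OF c[OF \<omega>] assms(5) l assms(13)])
  qed (rule pieces; assumption)+
qed

end
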